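(* Let $\lambda$ be a CPM (computable, proper, mixable) loss function. Let $F$ be a prediction algorithm and let $\zeta\in\mathbf{Z}^{\infty}$ be an infinite data sequence. If $\zeta$ is random with respect to $F$ under the log loss function, then $\zeta$ is random with respect to $F$ under $\lambda$.
   Context: Binary probabilistic prediction: a loss function is a pair $\lambda=(\lambda_0,\lambda_1)$ of functions $[0,1]\to\mathbb{R}\cup\{+\infty\}$, with $\lambda(p,y):=\lambda_y(p)$ the loss of predicting $p\in[0,1]$ (the predicted probability that the label is $1$) when the label is $y\in\{0,1\}$. It is assumed that $\lambda_0(0)=\lambda_1(1)=0$, $\lambda_0$ is increasing, $\lambda_1$ is decreasing, and $\lambda_y(p)<\infty$ unless $p\in\{0,1\}$. The loss function $\lambda$ is $\eta$-mixable ($\eta\in(0,\infty)$) if the set $\{(u,v)\in[0,1]^2 : \exists p\in[0,1],\ u\le e^{-\eta\lambda(p,0)},\ v\le e^{-\eta\lambda(p,1)}\}$ is convex, and mixable if it is $\eta$-mixable for some $\eta$. It is proper if $p\lambda(p,1)+(1-p)\lambda(p,0)\le p\lambda(q,1)+(1-p)\lambda(q,0)$ for all $p,q\in[0,1]$. A CPM loss function is one that is computable, proper and mixable. The log loss function is $\lambda_1(p)=-\ln p$, $\lambda_0(p)=-\ln(1-p)$. Data: $\mathbf{X}$ is a finite set of objects, $\mathbf{Z}=\mathbf{X}\times\{0,1\}$, $\mathbf{Z}^*$ the finite sequences over $\mathbf{Z}$ (with $\Box$ the empty sequence). A prediction algorithm is a computable function $F:\mathbf{Z}^*\times\mathbf{X}\to[0,1]$.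 For $\sigma=(z_1,\dots,z_T)$, $z_t=(x_t,y_t)$, the cumulative loss is $\mathrm{Loss}^{\lambda}_F(\sigma)=\sum_{t=1}^T\lambda(F(z_1,\dots,z_{t-1},x_t),y_t)$ (with $\infty+a=\infty$). A function $L:\mathbf{Z}^*\to\mathbb{R}\cup\{\infty\}$ is a superloss process under $\lambda$ if for all $\sigma\in\mathbf{Z}^*$ and $x\in\mathbf{X}$ there is $p\in[0,1]$ such that $L(\sigma,(x,y))\ge L(\sigma)+\lambda(p,y)$ for both $y\in\{0,1\}$. For computable mixable $\lambda$ there exists an upper semicomputable superloss process $\mathrm{K}^{\lambda}$ that is smallest up to an additive constant among upper semicomputable superloss processes (i.e. for every such $L$ there is $c$ with $\mathrm{K}^{\lambda}\le L+c$); one such is fixed and called the predictive complexity under $\lambda$. The randomness deficiency is $D^{\lambda}_F(\sigma)=\mathrm{Loss}^{\lambda}_F(\sigma)-\mathrm{K}^{\lambda}(\sigma)$. For $\zeta=(z_1,z_2,\dots)\in\mathbf{Z}^{\infty}$, $\zeta^T=(z_1,\dots,z_T)$, and $\zeta$ is random with respect to $F$ under $\lambda$ if $\sup_T D^{\lambda}_F(\zeta^T)<\infty$. *)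

theory Defs
  imports "HOL-Analysis.Analysis" "HOL-Library.Nat_Bijection"
begin

datatype recf =
    Zf
  | Sf
  | Idf nat
  | Cnf recf "recf list"
  | Prf recf recf
  | Mnf recf

inductive rec_eval :: "recf \<Rightarrow> nat list \<Rightarrow> nat \<Rightarrow> bool" where
  zero: "rec_eval Zf xs 0"
| succ: "rec_eval Sf (x # xs) (Suc x)"
| proj: "i < length xs \<Longrightarrow> rec_eval (Idf i) xs (xs ! i)"
| comp: "list_all2 (\<lambda>g y. rec_eval g xs y) gs ys \<Longrightarrow> rec_eval f ys z
          \<Longrightarrow> rec_eval (Cnf f gs) xs z"
| pr0: "rec_eval f xs y \<Longrightarrow> rec_eval (Prf f g) (0 # xs) y"
| prS: "rec_eval (Prf f g) (n # xs) y \<Longrightarrow> rec_eval g (n # y # xs) z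
          \<Longrightarrow> rec_eval (Prf f g) (Suc n # xs) z"
| mn: "rec_eval f (n # xs) 0 \<Longrightarrow> (\<forall>m<n. \<exists>y. rec_eval f (m # xs) (Suc y))
          \<Longrightarrow> rec_eval (Mnf f) xs n"

definition computable_nat :: "(nat \<Rightarrow> nat) \<Rightarrow> bool" where
  "computable_nat h \<longleftrightarrow> (\<exists>p. \<forall>n. rec_eval p [n] (h n))"

definition rat_of_code :: "nat \<Rightarrow> real" where
  "rat_of_code n = (case prod_decode n of (a, b) \<Rightarrow> real_of_int (int_decode a) / real (Suc b))"

definition eval_of_code :: "nat \<Rightarrow> ereal" where
  "eval_of_code n = (case n of 0 \<Rightarrow> \<infinity> | Suc c \<Rightarrow> ereal (rat_of_code c))"

text \<open>Objects are natural numbers (X is a finite set of them); labels are booleans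
(True = 1, False = 0).\<close>
type_synonym example = "nat \<times> bool"

definition code_example :: "example \<Rightarrow> nat" where
  "code_example z = prod_encode (fst z, if snd z then 1 else 0)"

definition code_seq :: "example list \<Rightarrow> nat" where
  "code_seq \<sigma> = list_encode (map code_example \<sigma>)"

definition Zstar :: "nat set \<Rightarrow> example list set" where
  "Zstar X = lists (X \<times> UNIV)"

definition real_name :: "(nat \<Rightarrow> nat) \<Rightarrow> real \<Rightarrow> bool" where
  "real_name r x \<longleftrightarrow> (\<forall>k. \<bar>rat_of_code (r k) - x\<bar> \<le> inverse (2 ^ k))"

text \<open>Type-2 computability of a function f : [0,1] \<rightarrow> R: a (total) machine reads a
finite prefix of a name of the input and a precision n; it answers 0 (need more input)
or Suc c, where c codes a 2^-n approximation of the output; on every name it eventually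
answers.\<close>
definition computable_on_unit :: "(real \<Rightarrow> real) \<Rightarrow> bool" where
  "computable_on_unit f \<longleftrightarrow> (\<exists>h. computable_nat h \<and>
     (\<forall>x\<in>{0..1}. \<forall>r. real_name r x \<longrightarrow> (\<forall>n.
        (\<exists>k. h (prod_encode (list_encode (map r [0..<k]), n)) \<noteq> 0) \<and>
        (\<forall>k c. h (prod_encode (list_encode (map r [0..<k]), n)) = Suc c
                 \<longrightarrow> \<bar>rat_of_code c - f x\<bar> \<le> inverse (2 ^ n)))))"

text \<open>A loss function is represented as lam y p = the loss of prediction p on label y.\<close>

definition loss_function :: "(bool \<Rightarrow> real \<Rightarrow> ereal) \<Rightarrow> bool" where
  "loss_function lam \<longleftrightarrow>
     lam False 0 = 0 \<and> lam True 1 = 0 \<and>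
     mono_on {0..1} (lam False) \<and> antimono_on {0..1} (lam True) \<and>
     (\<forall>y. \<forall>p\<in>{0..1}. lam y p \<noteq> -\<infinity>) \<and>
     (\<forall>y. \<forall>p\<in>{0<..<1}. lam y p < \<infinity>)"

definition eexp_neg :: "real \<Rightarrow> ereal \<Rightarrow> real" where
  "eexp_neg \<eta> v = (if v = \<infinity> then 0 else exp (- \<eta> * real_of_ereal v))"

definition mixable_with :: "real \<Rightarrow> (bool \<Rightarrow> real \<Rightarrow> ereal) \<Rightarrow> bool" where
  "mixable_with \<eta> lam \<longleftrightarrow> convex {(u::real, v::real). u \<in> {0..1} \<and> v \<in> {0..1} \<and>
      (\<exists>p\<in>{0..1}. u \<le> eexp_neg \<eta> (lam False p) \<and> v \<le> eexp_neg \<eta> (lam True p))}"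

definition mixable :: "(bool \<Rightarrow> real \<Rightarrow> ereal) \<Rightarrow> bool" where
  "mixable lam \<longleftrightarrow> (\<exists>\<eta>>0. mixable_with \<eta> lam)"

text \<open>Properness, with the convention 0 * \<infinity> = 0 of ereal.\<close>
definition proper :: "(bool \<Rightarrow> real \<Rightarrow> ereal) \<Rightarrow> bool" where
  "proper lam \<longleftrightarrow> (\<forall>p\<in>{0..1}. \<forall>q\<in>{0..1}.
     ereal p * lam True p + ereal (1 - p) * lam False p
       \<le> ereal p * lam True q + ereal (1 - p) * lam False q)"

text \<open>Computability of a loss function: each lam y, viewed as a map from [0,1] to
[0,\<infinity>] (topologised as usual, i.e. via v \<mapsto> exp(-v)), is computable.\<close>
definition computable_loss :: "(bool \<Rightarrow> real \<Rightarrow> ereal) \<Rightarrow> bool" where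
  "computable_loss lam \<longleftrightarrow> (\<forall>y. computable_on_unit (\<lambda>p. eexp_neg 1 (lam y p)))"

definition CPM_loss :: "(bool \<Rightarrow> real \<Rightarrow> ereal) \<Rightarrow> bool" where
  "CPM_loss lam \<longleftrightarrow> loss_function lam \<and> computable_loss lam \<and> proper lam \<and> mixable lam"

definition log_loss :: "bool \<Rightarrow> real \<Rightarrow> ereal" where
  "log_loss y p = (if y then (if p = 0 then \<infinity> else ereal (- ln p))
                   else (if p = 1 then \<infinity> else ereal (- ln (1 - p))))"

definition prediction_algorithm :: "nat set \<Rightarrow> (example list \<Rightarrow> nat \<Rightarrow> real) \<Rightarrow> bool" where
  "prediction_algorithm X F \<longleftrightarrow>
     (\<forall>\<sigma>\<in>Zstar X. \<forall>x\<in>X. F \<sigma> x \<in> {0..1}) \<and>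
     (\<exists>h. computable_nat h \<and> (\<forall>\<sigma>\<in>Zstar X. \<forall>x\<in>X. \<forall>n.
        \<bar>rat_of_code (h (prod_encode (code_seq \<sigma>, prod_encode (x, n)))) - F \<sigma> x\<bar>
          \<le> inverse (2 ^ n)))"

definition Loss :: "(bool \<Rightarrow> real \<Rightarrow> ereal) \<Rightarrow> (example list \<Rightarrow> nat \<Rightarrow> real)
                     \<Rightarrow> example list \<Rightarrow> ereal" where
  "Loss lam F \<sigma> = (\<Sum>t<length \<sigma>. lam (snd (\<sigma> ! t)) (F (take t \<sigma>) (fst (\<sigma> ! t))))"

definition superloss_process :: "nat set \<Rightarrow> (bool \<Rightarrow> real \<Rightarrow> ereal) \<Rightarrow> (example list \<Rightarrow> ereal) \<Rightarrow> bool" where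
  "superloss_process X lam L \<longleftrightarrow>
     (\<forall>\<sigma>\<in>Zstar X. L \<sigma> \<noteq> -\<infinity>) \<and>
     (\<forall>\<sigma>\<in>Zstar X. \<forall>x\<in>X. \<exists>p\<in>{0..1}. \<forall>y. L (\<sigma> @ [(x, y)]) \<ge> L \<sigma> + lam y p)"

definition upper_semicomputable :: "nat set \<Rightarrow> (example list \<Rightarrow> ereal) \<Rightarrow> bool" where
  "upper_semicomputable X L \<longleftrightarrow> (\<exists>h. computable_nat h \<and> (\<forall>\<sigma>\<in>Zstar X.
      antimono (\<lambda>n. eval_of_code (h (prod_encode (code_seq \<sigma>, n)))) \<and>
      (INF n. eval_of_code (h (prod_encode (code_seq \<sigma>, n)))) = L \<sigma>))"

definition predictive_complexity :: "nat set \<Rightarrow> (bool \<Rightarrow> real \<Rightarrow> ereal) \<Rightarrow> (example list \<Rightarrow> ereal) \<Rightarrow> bool" where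
  "predictive_complexity X lam K \<longleftrightarrow>
     upper_semicomputable X K \<and> superloss_process X lam K \<and>
     (\<forall>L. upper_semicomputable X L \<and> superloss_process X lam L \<longrightarrow>
        (\<exists>c::real. \<forall>\<sigma>\<in>Zstar X. K \<sigma> \<le> L \<sigma> + ereal c))"

definition deficiency :: "(bool \<Rightarrow> real \<Rightarrow> ereal) \<Rightarrow> (example list \<Rightarrow> nat \<Rightarrow> real)
                           \<Rightarrow> (example list \<Rightarrow> ereal) \<Rightarrow> example list \<Rightarrow> ereal" where
  "deficiency lam F K \<sigma> = Loss lam F \<sigma> - K \<sigma>"

definition prefix_of :: "(nat \<Rightarrow> example) \<Rightarrow> nat \<Rightarrow> example list" where
  "prefix_of \<zeta> T = map \<zeta> [0..<T]"

definition random_wrt :: "(bool \<Rightarrow> real \<Rightarrow> ereal) \<Rightarrow> (example list \<Rightarrow> nat \<Rightarrow> real)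
                          \<Rightarrow> (example list \<Rightarrow> ereal) \<Rightarrow> (nat \<Rightarrow> example) \<Rightarrow> bool" where
  "random_wrt lam F K \<zeta> \<longleftrightarrow> (SUP T. deficiency lam F K (prefix_of \<zeta> T)) < \<infinity>"

end

theory Submission
  imports Defs
begin

text \<open>For a proper \<open>\<eta>\<close>-mixable loss and \<open>1 / N \<le> \<eta>\<close>, first order optimality of the honest
  prediction gives \<open>\<Sum>\<^sub>y p\<^sub>y exp ((\<lambda>(p, y) - \<lambda>(q, y)) / N) \<le> 1\<close> for all \<open>p\<close>, \<open>q\<close>, where
  \<open>p\<^sub>y\<close> is the probability of the label \<open>y\<close>.
  Hence \<open>L = Loss\<^bsup>log\<^esup> - (Loss\<^bsup>\<lambda>\<^esup> - K\<^bsup>\<lambda>\<^esup>) / N\<close>, set to \<open>\<infinity>\<close> where the log loss is infinite,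
  is a superloss process under the log loss. It is upper semicomputable, so \<open>K\<^bsup>log\<^esup> \<le> L + c\<close>,
  which says that the deficiency under \<open>\<lambda>\<close> is at most \<open>N\<close> times that under the log loss,
  up to an additive constant.\<close>

section \<open>Recursive functions\<close>

text \<open>The rate \<open>1 / N\<close> replaces \<open>\<eta>\<close> because
  \<open>\<eta>\<close> is an arbitrary real, possibly not computable, whereas with
  \<open>1 / N\<close> comparing the process with a rational becomes, after exponentiation, an
  inequality between products and integer powers. Lowering the rate is harmless by convexity of exp.

  The delicate point is upper semicomputability. Predictions and losses are known only through
  approximations, so it cannot be decided whether a prediction is 0 or 1, hence whether the process
  is infinite. Finite upper bounds are therefore certified by strict inequalities between rationals,
  with the probability of the labels approximated from below and exp(-Loss) from above. On a
  sequence of probability 0 no certificate holds, so the infimum over certificates is \<infinity>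
  there without any decision having been made. \<open>K\<close> is known from above only, which
  suffices since its coefficient is positive.

  Computability means having a program in \<open>recf\<close>, so the decidability of certificates
  has to be built up from primitive recursion.\<close>

definition recursive :: "nat \<Rightarrow> (nat list \<Rightarrow> nat) \<Rightarrow> bool" where
  "recursive k f \<longleftrightarrow> (\<exists>p. \<forall>xs. length xs = k \<longrightarrow> rec_eval p xs (f xs))"

lemma computable_nat_iff: "computable_nat f \<longleftrightarrow> recursive 1 (\<lambda>xs. f (xs ! 0))"
proof -
  have "(\<forall>n. rec_eval p [n] (f n)) \<longleftrightarrow> (\<forall>xs. length xs = 1 \<longrightarrow> rec_eval p xs (f (xs ! 0)))" for p
    by (auto simp: length_Suc_conv)
  then show ?thesis
    unfolding computable_nat_def recursive_def by simp
qed

lemma recursive_nth: "i < k \<Longrightarrow> recursive k (\<lambda>xs. xs ! i)"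
  unfolding recursive_def using rec_eval.proj by blast

lemma recursive_comp1:
  assumes "recursive 1 (\<lambda>xs. f (xs ! 0))" "recursive k g"
  shows "recursive k (\<lambda>xs. f (g xs))"
proof -
  obtain p q where p: "\<And>xs. length xs = 1 \<Longrightarrow> rec_eval p xs (f (xs ! 0))"
    and q: "\<And>xs. length xs = k \<Longrightarrow> rec_eval q xs (g xs)"
    using assms unfolding recursive_def by blast
  have "rec_eval (Cnf p [q]) xs (f (g xs))" if "length xs = k" for xs
    using p[of "[g xs]"] q[OF that] by (intro rec_eval.comp[where ys = "[g xs]"]) auto
  then show ?thesis unfolding recursive_def by blast
qed

lemma recursive_comp2:
  assumes "recursive 2 (\<lambda>xs. f (xs ! 0) (xs ! 1))" "recursive k g" "recursive k h"
  shows "recursive k (\<lambda>xs. f (g xs) (h xs))"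
proof -
  obtain p q r where p: "\<And>xs. length xs = 2 \<Longrightarrow> rec_eval p xs (f (xs ! 0) (xs ! 1))"
    and q: "\<And>xs. length xs = k \<Longrightarrow> rec_eval q xs (g xs)"
    and r: "\<And>xs. length xs = k \<Longrightarrow> rec_eval r xs (h xs)"
    using assms unfolding recursive_def by blast
  have "rec_eval (Cnf p [q, r]) xs (f (g xs) (h xs))" if "length xs = k" for xs
    using p[of "[g xs, h xs]"] q[OF that] r[OF that]
    by (intro rec_eval.comp[where ys = "[g xs, h xs]"]) auto
  then show ?thesis unfolding recursive_def by blast
qed

lemma recursive_Suc: "recursive k f \<Longrightarrow> recursive k (\<lambda>xs. Suc (f xs))"
proof (rule recursive_comp1[where f = Suc])
  have "rec_eval Sf xs (Suc (xs ! 0))" if "length xs = 1" for xs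
    using that rec_eval.succ[of "xs ! 0" "[]"] by (cases xs) auto
  then show "recursive 1 (\<lambda>xs. Suc (xs ! 0))"
    unfolding recursive_def by blast
qed

lemma recursive_const: "recursive k (\<lambda>xs. c)"
proof (induction c)
  case 0
  then show ?case unfolding recursive_def using rec_eval.zero by blast
next
  case (Suc c)
  then show ?case by (rule recursive_Suc)
qed

lemma recursive_rec_nat:
  assumes "recursive k b" "recursive (Suc (Suc k)) s" "recursive k m"
  shows "recursive k (\<lambda>xs. rec_nat (b xs) (\<lambda>i y. s (i # y # xs)) (m xs))"
proof -
  obtain p q r where p: "\<And>xs. length xs = k \<Longrightarrow> rec_eval p xs (b xs)"
    and q: "\<And>xs. length xs = Suc (Suc k) \<Longrightarrow> rec_eval q xs (s xs)"
    and r: "\<And>xs. length xs = k \<Longrightarrow> rec_eval r xs (m xs)"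
    using assms unfolding recursive_def by blast
  have *: "rec_eval (Prf p q) (n # xs) (rec_nat (b xs) (\<lambda>i y. s (i # y # xs)) n)"
    if "length xs = k" for xs n
  proof (induction n)
    case 0
    show ?case using p[OF that] by (simp add: rec_eval.pr0)
  next
    case (Suc n)
    from rec_eval.prS[OF Suc q] that show ?case by simp
  qed
  \<comment> \<open>\<open>Prf\<close> recurses on the head of its argument list, so the count
    \<open>m xs\<close> goes in front and the projections pass the parameters through.\<close>
  have "rec_eval (Cnf (Prf p q) (r # map Idf [0..<k])) xs
          (rec_nat (b xs) (\<lambda>i y. s (i # y # xs)) (m xs))" if "length xs = k" for xs
    using *[OF that, of "m xs"] r[OF that] that
    by (intro rec_eval.comp[where ys = "m xs # xs"])
       (auto simp: list_all2_conv_all_nth nth_Cons intro: rec_eval.proj split: nat.split)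
  then show ?thesis unfolding recursive_def by blast
qed

lemma recursive_add: "recursive k f \<Longrightarrow> recursive k g \<Longrightarrow> recursive k (\<lambda>xs. f xs + g xs)"
proof (rule recursive_comp2[where f = "(+)"])
  have "recursive 2 (\<lambda>xs. rec_nat (xs ! 0) (\<lambda>i y. (\<lambda>ys. Suc (ys ! 1)) (i # y # xs)) (xs ! 1))"
    by (intro recursive_rec_nat recursive_nth recursive_Suc) auto
  moreover have "rec_nat x (\<lambda>i. Suc) n = x + n" for x n by (induction n) auto
  ultimately show "recursive 2 (\<lambda>xs. xs ! 0 + xs ! 1)" by simp
qed

lemma recursive_pred: "recursive k f \<Longrightarrow> recursive k (\<lambda>xs. f xs - 1)"
proof (rule recursive_comp1[where f = "\<lambda>n. n - 1"])
  have "recursive 1 (\<lambda>xs. rec_nat 0 (\<lambda>i y. (\<lambda>ys. ys ! 0) (i # y # xs)) (xs ! 0))"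
    by (intro recursive_rec_nat recursive_nth recursive_const) auto
  moreover have "rec_nat 0 (\<lambda>i y. i) n = n - 1" for n by (cases n) auto
  ultimately show "recursive 1 (\<lambda>xs. xs ! 0 - 1)" by simp
qed

lemma recursive_diff: "recursive k f \<Longrightarrow> recursive k g \<Longrightarrow> recursive k (\<lambda>xs. f xs - g xs)"
proof (rule recursive_comp2[where f = "(-)"])
  have "recursive 2 (\<lambda>xs. rec_nat (xs ! 0) (\<lambda>i y. (\<lambda>ys. ys ! 1 - 1) (i # y # xs)) (xs ! 1))"
    by (intro recursive_rec_nat recursive_nth recursive_pred) auto
  moreover have "rec_nat x (\<lambda>i y. y - Suc 0) n = x - n" for x n by (induction n) auto
  ultimately show "recursive 2 (\<lambda>xs. xs ! 0 - xs ! 1)" by simp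
qed

section \<open>Cantor pairing and its inverse\<close>

lemma recursive_triangle: "recursive k f \<Longrightarrow> recursive k (\<lambda>xs. triangle (f xs))"
proof (rule recursive_comp1[where f = triangle])
  have "recursive 1 (\<lambda>xs. rec_nat 0 (\<lambda>i y. (\<lambda>ys. ys ! 1 + Suc (ys ! 0)) (i # y # xs)) (xs ! 0))"
    by (intro recursive_rec_nat recursive_nth recursive_const recursive_add recursive_Suc) auto
  moreover have "rec_nat 0 (\<lambda>i y. Suc (y + i)) n = triangle n" for n by (induction n) auto
  ultimately show "recursive 1 (\<lambda>xs. triangle (xs ! 0))" by simp
qed

lemma recursive_prod_encode:
  "recursive k f \<Longrightarrow> recursive k g \<Longrightarrow> recursive k (\<lambda>xs. prod_encode (f xs, g xs))"
  unfolding prod_encode_def by (simp add: recursive_add recursive_triangle)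

text \<open>The largest \<open>t\<close> with \<open>triangle t \<le> n\<close>: the truncated
  difference contributes 1 exactly when \<open>triangle (Suc y) \<le> Suc i\<close>. Since
  \<open>prod_encode (a, b)\<close> is \<open>triangle (a + b) + a\<close>, this recovers
  \<open>a + b\<close> and from it both components.\<close>

definition triangle_root :: "nat \<Rightarrow> nat" where
  "triangle_root = rec_nat 0 (\<lambda>i y. y + (1 - (triangle (Suc y) - Suc i)))"

lemma recursive_triangle_root: "recursive k f \<Longrightarrow> recursive k (\<lambda>xs. triangle_root (f xs))"
proof (rule recursive_comp1[where f = triangle_root])
  have "recursive 1 (\<lambda>xs. rec_nat 0 (\<lambda>i y.
      (\<lambda>ys. ys ! 1 + (1 - (triangle (Suc (ys ! 1)) - Suc (ys ! 0)))) (i # y # xs)) (xs ! 0))"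
    by (intro recursive_rec_nat recursive_nth recursive_const recursive_add recursive_Suc
        recursive_diff recursive_triangle) auto
  then show "recursive 1 (\<lambda>xs. triangle_root (xs ! 0))"
    unfolding triangle_root_def by (simp only: nth_Cons_0 nth_Cons_Suc One_nat_def)
qed

lemma triangle_root_bounds:
  "triangle (triangle_root n) \<le> n \<and> n < triangle (Suc (triangle_root n))"
proof (induction n)
  case 0
  show ?case by (simp add: triangle_root_def)
next
  case (Suc n)
  define t where "t = triangle_root n"
  have "triangle_root (Suc n) = t + (1 - (triangle (Suc t) - Suc n))"
    by (simp add: triangle_root_def t_def)
  moreover have "triangle t \<le> n" "n < triangle (Suc t)"
    using Suc t_def by auto
  ultimately show ?case
    by (cases "triangle (Suc t) = Suc n") auto
qed

lemma mono_triangle: "m \<le> n \<Longrightarrow> triangle m \<le> triangle n"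
  by (rule lift_Suc_mono_le[where f = triangle]) auto

lemma triangle_root_eq: "triangle_root (prod_encode (a, b)) = a + b"
proof -
  let ?n = "prod_encode (a, b)"
  have "triangle (a + b) \<le> ?n" "?n < triangle (Suc (a + b))"
    by (simp_all add: prod_encode_def)
  moreover have "triangle (triangle_root ?n) \<le> ?n" "?n < triangle (Suc (triangle_root ?n))"
    using triangle_root_bounds by blast+
  moreover have "\<not> Suc (triangle_root ?n) \<le> a + b"
    using mono_triangle[of "Suc (triangle_root ?n)" "a + b"] calculation by linarith
  moreover have "\<not> Suc (a + b) \<le> triangle_root ?n"
    using mono_triangle[of "Suc (a + b)" "triangle_root ?n"] calculation by linarith
  ultimately show ?thesis by linarith
qed

lemma recursive_fst_prod_decode:
  "recursive k f \<Longrightarrow> recursive k (\<lambda>xs. fst (prod_decode (f xs)))"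
proof -
  have "fst (prod_decode n) = n - triangle (triangle_root n)" for n
  proof (cases "prod_decode n")
    case (Pair a b)
    then have "n = prod_encode (a, b)" by (metis prod_decode_inverse)
    with Pair show ?thesis
      by (simp only: triangle_root_eq) (simp add: prod_encode_def)
  qed
  then show "recursive k f \<Longrightarrow> ?thesis"
    by (simp add: recursive_diff recursive_triangle recursive_triangle_root)
qed

lemma recursive_snd_prod_decode:
  "recursive k f \<Longrightarrow> recursive k (\<lambda>xs. snd (prod_decode (f xs)))"
proof -
  have "snd (prod_decode n) = triangle_root n - fst (prod_decode n)" for n
  proof (cases "prod_decode n")
    case (Pair a b)
    then have "n = prod_encode (a, b)" by (metis prod_decode_inverse)
    with Pair show ?thesis
      by (simp add: triangle_root_eq)
  qed
  then show "recursive k f \<Longrightarrow> ?thesis"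
    by (simp add: recursive_diff recursive_triangle_root recursive_fst_prod_decode)
qed

section \<open>Computable functions of one number\<close>

lemma computable_nat_comp: "computable_nat f \<Longrightarrow> computable_nat g \<Longrightarrow> computable_nat (\<lambda>n. f (g n))"
  unfolding computable_nat_iff by (rule recursive_comp1)

lemma computable_nat_id: "computable_nat (\<lambda>n. n)"
  unfolding computable_nat_iff by (rule recursive_nth) simp

lemma computable_nat_const: "computable_nat (\<lambda>n. c)"
  unfolding computable_nat_iff by (rule recursive_const)

lemma computable_nat_Suc: "computable_nat Suc"
  unfolding computable_nat_iff by (intro recursive_Suc recursive_nth) simp

lemma computable_nat_prod_encode:
  "computable_nat f \<Longrightarrow> computable_nat g \<Longrightarrow> computable_nat (\<lambda>n. prod_encode (f n, g n))"
  unfolding computable_nat_iff by (rule recursive_prod_encode)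

lemma computable_nat_prod_decode:
  "computable_nat (\<lambda>n. fst (prod_decode n))" "computable_nat (\<lambda>n. snd (prod_decode n))"
  unfolding computable_nat_iff
  by (intro recursive_fst_prod_decode recursive_snd_prod_decode recursive_nth, simp)+

text \<open>Counter, accumulator and parameter are packed into one number, so that functions of
  several arguments can be handled as unary ones from here on.\<close>

lemma computable_nat_rec_nat:
  assumes "computable_nat b" "computable_nat s" "computable_nat m"
  shows "computable_nat (\<lambda>n. rec_nat (b n) (\<lambda>i y. s (prod_encode (i, prod_encode (y, n)))) (m n))"
proof -
  have "recursive (Suc (Suc 1)) (\<lambda>ys. s (prod_encode (ys ! 0, prod_encode (ys ! 1, ys ! 2))))"
    by (rule recursive_comp1[where f = s, OF assms(2)[unfolded computable_nat_iff]])
       (intro recursive_prod_encode recursive_nth; simp)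
  from recursive_rec_nat[OF assms(1)[unfolded computable_nat_iff] this assms(3)[unfolded computable_nat_iff]]
  show ?thesis unfolding computable_nat_iff by simp
qed

section \<open>Effective functions between coded types\<close>

class coded =
  fixes encode :: "'a \<Rightarrow> nat"

instantiation nat :: coded
begin
definition encode_nat :: "nat \<Rightarrow> nat" where "encode_nat n = n"
instance ..
end

instantiation bool :: coded
begin
definition encode_bool :: "bool \<Rightarrow> nat" where "encode_bool b = of_bool b"
instance ..
end

instantiation prod :: (coded, coded) coded
begin
definition encode_prod :: "'a \<times> 'b \<Rightarrow> nat" where
  "encode_prod z = prod_encode (encode (fst z), encode (snd z))"
instance ..
end

instantiation list :: (coded) coded
begin
definition encode_list :: "'a list \<Rightarrow> nat" where "encode_list xs = list_encode (map encode xs)"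
instance ..
end

lemma code_seq_eq_encode: "code_seq = encode"
proof -
  have "code_example = encode"
    by (auto simp: fun_eq_iff code_example_def encode_prod_def encode_nat_def encode_bool_def)
  then show ?thesis
    by (intro ext) (simp add: code_seq_def encode_list_def)
qed

text \<open>A program on codes tracks the function; its values outside the range of
  \<open>encode\<close> are free.\<close>

definition effective :: "('a::coded \<Rightarrow> 'b::coded) \<Rightarrow> bool" where
  "effective f \<longleftrightarrow> (\<exists>h. computable_nat h \<and> (\<forall>x. h (encode x) = encode (f x)))"

named_theorems effective_intros

lemma effective_compose: "effective f \<Longrightarrow> effective g \<Longrightarrow> effective (\<lambda>x. f (g x))"
  unfolding effective_def using computable_nat_comp by metis

lemma effective_id [effective_intros]: "effective (\<lambda>x. x)"
  unfolding effective_def using computable_nat_id by auto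

lemma effective_const [effective_intros]: "effective (\<lambda>x. c)"
  unfolding effective_def using computable_nat_const by blast

lemma effective_nat: "computable_nat h \<Longrightarrow> effective f \<Longrightarrow> effective (\<lambda>x. h (f x))"
  by (rule effective_compose[of h]) (simp_all only: effective_def encode_nat_def, blast)

lemma effective_Pair [effective_intros]:
  assumes "effective f" "effective g"
  shows "effective (\<lambda>x. (f x, g x))"
proof -
  obtain h k where h: "computable_nat h" "computable_nat k"
    and eq: "\<And>x. h (encode x) = encode (f x)" "\<And>x. k (encode x) = encode (g x)"
    using assms unfolding effective_def by blast
  show ?thesis
    unfolding effective_def
    by (intro exI conjI, rule computable_nat_prod_encode[OF h]) (simp add: eq encode_prod_def)
qed

lemma effective_fst [effective_intros]: "effective f \<Longrightarrow> effective (\<lambda>x. fst (f x))"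
proof (rule effective_compose[of fst])
  show "effective (fst :: 'b \<times> 'c \<Rightarrow> 'b)"
    unfolding effective_def
    by (intro exI conjI, rule computable_nat_prod_decode(1)) (simp add: encode_prod_def)
qed

lemma effective_snd [effective_intros]: "effective f \<Longrightarrow> effective (\<lambda>x. snd (f x))"
proof (rule effective_compose[of snd])
  show "effective (snd :: 'b \<times> 'c \<Rightarrow> 'c)"
    unfolding effective_def
    by (intro exI conjI, rule computable_nat_prod_decode(2)) (simp add: encode_prod_def)
qed

lemma effective_rec_nat [effective_intros]:
  fixes m :: "'a::coded \<Rightarrow> nat" and b :: "'a \<Rightarrow> 'b::coded"
  assumes "effective b" "effective (\<lambda>e. s (fst e) (fst (snd e)) (snd (snd e)))" "effective m"
  shows "effective (\<lambda>x. rec_nat (b x) (\<lambda>i y. s i y x) (m x))"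
proof -
  obtain hb hs hm where h: "computable_nat hb" "computable_nat hs" "computable_nat hm"
    and hb: "\<And>x. hb (encode x) = encode (b x)"
    and hs: "\<And>e. hs (encode e) = encode (s (fst e) (fst (snd e)) (snd (snd e)))"
    and hm: "\<And>x. hm (encode x) = m x"
    using assms unfolding effective_def encode_nat_def by metis
  have "rec_nat (hb (encode x)) (\<lambda>i y. hs (prod_encode (i, prod_encode (y, encode x)))) n
      = encode (rec_nat (b x) (\<lambda>i y. s i y x) n)" for x n
    by (induction n)
       (use hs[of "(_, _, x)"] in \<open>auto simp: hb encode_prod_def encode_nat_def\<close>)
  with computable_nat_rec_nat[OF h] show ?thesis
    unfolding effective_def by (intro exI conjI) (auto simp: hm)
qed

lemma effective_encode: "effective f \<Longrightarrow> effective (\<lambda>x. encode (f x))"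
  unfolding effective_def encode_nat_def .

lemma effective_prod_encode [effective_intros]:
  "effective f \<Longrightarrow> effective g \<Longrightarrow> effective (\<lambda>x. prod_encode (f x, g x))"
  using effective_encode[OF effective_Pair[of f g]] by (simp add: encode_prod_def encode_nat_def)

lemma effective_prod_decode [effective_intros]:
  "effective f \<Longrightarrow> effective (\<lambda>x. fst (prod_decode (f x)))"
  "effective f \<Longrightarrow> effective (\<lambda>x. snd (prod_decode (f x)))"
  by (rule effective_nat; simp add: computable_nat_prod_decode)+

text \<open>The identity on numbers tracks \<open>inv encode\<close>, because
  \<open>encode (inv encode n) = n\<close>. This lets a search over natural numbers run over
  tuples.\<close>

lemma effective_inv_encode:
  assumes "bij (encode :: 'a::coded \<Rightarrow> nat)"
  shows "effective (inv encode :: nat \<Rightarrow> 'a)"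
  unfolding effective_def
  by (rule exI[of _ "\<lambda>n. n"])
     (simp add: computable_nat_id surj_f_inv_f bij_is_surj[OF assms] encode_nat_def)

lemma bij_encode_nat: "bij (encode :: nat \<Rightarrow> nat)"
  unfolding encode_nat_def by (simp add: bij_def)

lemma bij_encode_prod:
  assumes "bij (encode :: 'a::coded \<Rightarrow> nat)" "bij (encode :: 'b::coded \<Rightarrow> nat)"
  shows "bij (encode :: 'a \<times> 'b \<Rightarrow> nat)"
proof -
  have "(encode :: 'a \<times> 'b \<Rightarrow> nat) = prod_encode \<circ> map_prod encode encode"
    by (auto simp: encode_prod_def)
  moreover have "bij (map_prod encode encode :: 'a \<times> 'b \<Rightarrow> nat \<times> nat)"
    using assms by (simp add: bij_def prod.inj_map map_prod_surj)
  ultimately show ?thesis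
    using bij_comp[OF _ bij_prod_encode] by metis
qed

section \<open>Arithmetic and Boolean operations\<close>

lemma effective_Suc [effective_intros]: "effective f \<Longrightarrow> effective (\<lambda>x. Suc (f x))"
  by (rule effective_nat[OF computable_nat_Suc])

lemma effective_add [effective_intros]:
  fixes f g :: "'a::coded \<Rightarrow> nat"
  shows "effective f \<Longrightarrow> effective g \<Longrightarrow> effective (\<lambda>x. f x + g x)"
proof -
  have "m + n = rec_nat m (\<lambda>_ y. Suc y) n" for m n :: nat by (induction n) auto
  then show "effective f \<Longrightarrow> effective g \<Longrightarrow> ?thesis"
    by (simp only:) (intro effective_intros)
qed

lemma effective_mult [effective_intros]:
  fixes f g :: "'a::coded \<Rightarrow> nat"
  assumes "effective f" "effective g"
  shows "effective (\<lambda>x. f x * g x)"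
proof -
  have *: "m * n = rec_nat 0 (\<lambda>_ y. y + m) n" for m n :: nat by (induction n) auto
  show ?thesis
    unfolding * by (intro effective_intros effective_compose[OF assms(1)] assms)
qed

lemma effective_diff [effective_intros]:
  fixes f g :: "'a::coded \<Rightarrow> nat"
  shows "effective f \<Longrightarrow> effective g \<Longrightarrow> effective (\<lambda>x. f x - g x)"
proof -
  have pred: "n - 1 = rec_nat 0 (\<lambda>i _. i) n" for n :: nat by (cases n) auto
  have "m - n = rec_nat m (\<lambda>_ y. rec_nat 0 (\<lambda>i _. i) y) n" for m n :: nat
    by (induction n) (auto simp flip: pred)
  then show "effective f \<Longrightarrow> effective g \<Longrightarrow> ?thesis"
    by (simp only:) (intro effective_intros)
qed

text \<open>The condition has code 0 or 1, so a recursion of that length either keeps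
  \<open>g x\<close> or replaces it once by \<open>f x\<close>.\<close>

lemma effective_if [effective_intros]:
  assumes "effective c" "effective f" "effective g"
  shows "effective (\<lambda>x. if c x then f x else g x)"
proof -
  have *: "(if c x then f x else g x) = rec_nat (g x) (\<lambda>_ _. f x) (encode (c x))" for x
    by (simp add: encode_bool_def)
  show ?thesis
    unfolding * by (intro effective_intros effective_encode effective_compose[OF assms(2)] assms)
qed

lemma effective_of_bool:
  assumes "effective (\<lambda>x. of_bool (c x) :: nat)"
  shows "effective c"
  using assms unfolding effective_def encode_nat_def encode_bool_def .

lemma effective_less [effective_intros]:
  fixes f g :: "'a::coded \<Rightarrow> nat"
  assumes "effective f" "effective g"
  shows "effective (\<lambda>x. f x < g x)"
proof (rule effective_of_bool)
  have "of_bool (m < n) = 1 - (1 - (n - m))" for m n :: nat by auto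
  then show "effective (\<lambda>x. of_bool (f x < g x) :: nat)"
    by (simp only:) (intro effective_intros assms)
qed

lemma effective_Not [effective_intros]: "effective c \<Longrightarrow> effective (\<lambda>x. \<not> c x)"
proof (rule effective_of_bool)
  have "of_bool (\<not> b) = 1 - encode b" for b
    by (simp add: encode_bool_def)
  then show "effective c \<Longrightarrow> effective (\<lambda>x. of_bool (\<not> c x) :: nat)"
    by (simp only:) (intro effective_intros effective_encode)
qed

lemma effective_even [effective_intros]:
  fixes f :: "'a::coded \<Rightarrow> nat"
  shows "effective f \<Longrightarrow> effective (\<lambda>x. even (f x))"
proof -
  have "even n = rec_nat True (\<lambda>_ b. \<not> b) n" for n :: nat by (induction n) auto
  then show "effective f \<Longrightarrow> ?thesis"
    by (simp only:) (intro effective_intros)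
qed

lemma effective_half [effective_intros]:
  fixes f :: "'a::coded \<Rightarrow> nat"
  shows "effective f \<Longrightarrow> effective (\<lambda>x. f x div 2)"
proof -
  have "n div 2 = rec_nat 0 (\<lambda>i y. if even i then y else Suc y) n" for n :: nat
    by (induction n) auto
  then show "effective f \<Longrightarrow> ?thesis"
    by (simp only:) (intro effective_intros)
qed

subsection \<open>Lists\<close>

lemma effective_Cons [effective_intros]:
  "effective f \<Longrightarrow> effective g \<Longrightarrow> effective (\<lambda>x. f x # g x)"
proof -
  have 1: "encode (f x # g x) = Suc (encode (f x, g x))" for x
    by (simp add: encode_list_def encode_prod_def)
  show "effective f \<Longrightarrow> effective g \<Longrightarrow> ?thesis"
    using effective_Suc[OF effective_encode[OF effective_Pair[of f g]]]
    unfolding effective_def encode_nat_def 1 .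
qed

lemma effective_null [effective_intros]: "effective f \<Longrightarrow> effective (\<lambda>x. f x = [])"
proof (rule effective_of_bool)
  have "of_bool (xs = []) = 1 - encode xs" for xs :: "'b list"
    by (cases xs) (auto simp: encode_list_def)
  then show "effective f \<Longrightarrow> effective (\<lambda>x. of_bool (f x = []) :: nat)"
    by (simp only:) (intro effective_intros effective_encode)
qed

lemma effective_tl [effective_intros]: "effective f \<Longrightarrow> effective (\<lambda>x. tl (f x))"
proof (rule effective_compose[of tl])
  have "snd (prod_decode (encode xs - 1)) = encode (tl xs)" for xs :: "'b list"
  proof (cases xs)
    case Nil
    \<comment> \<open>The code of \<open>[]\<close> is 0, truncated subtraction keeps it 0, and its
      second component is again 0, the code of \<open>tl []\<close>.\<close>
    have "prod_decode 0 = (0, 0)"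
      using prod_encode_inverse[of "(0, 0)"] by (simp add: prod_encode_def del: prod_encode_inverse)
    with Nil show ?thesis by (simp add: encode_list_def)
  qed (simp add: encode_list_def)
  moreover have "computable_nat (\<lambda>n. snd (prod_decode (n - 1)))"
    by (rule computable_nat_comp[OF computable_nat_prod_decode(2)],
        unfold computable_nat_iff, rule recursive_pred, rule recursive_nth) simp
  ultimately show "effective (tl :: 'b list \<Rightarrow> _)"
    unfolding effective_def by blast
qed

lemma effective_hd [effective_intros]:
  fixes f :: "'a::coded \<Rightarrow> 'b::coded list"
  shows "effective f \<Longrightarrow> effective (\<lambda>x. hd (f x))"
proof (rule effective_compose[of hd])
  \<comment> \<open>\<open>hd []\<close> is unspecified but fixed, so its code can be built into the
    program as a constant.\<close>
  define c where "c = encode (hd [] :: 'b)"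
  define h where "h n = (if 0 < n then fst (prod_decode (n - 1)) else c)" for n
  have "h (encode xs) = encode (hd xs)" for xs :: "'b list"
    by (cases xs) (auto simp: encode_list_def h_def c_def)
  moreover have "effective h"
    unfolding h_def
    by (intro effective_intros)
  then have "computable_nat h"
    unfolding effective_def encode_nat_def by (metis ext)
  ultimately show "effective (hd :: 'b list \<Rightarrow> _)"
    unfolding effective_def by blast
qed

lemma effective_drop [effective_intros]:
  fixes m :: "'a::coded \<Rightarrow> nat"
  shows "effective m \<Longrightarrow> effective f \<Longrightarrow> effective (\<lambda>x. drop (m x) (f x))"
proof -
  have "drop n xs = rec_nat xs (\<lambda>_ y. tl y) n" for n and xs :: "'b list"
    by (induction n) (simp_all add: drop_Suc flip: tl_drop)
  then show "effective m \<Longrightarrow> effective f \<Longrightarrow> ?thesis"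
    by (simp only:) (intro effective_intros)
qed

lemma effective_sum:
  fixes m :: "'a::coded \<Rightarrow> nat" and f :: "nat \<Rightarrow> 'a \<Rightarrow> nat"
  assumes "effective (\<lambda>e. f (fst e) (snd e))" "effective m"
  shows "effective (\<lambda>x. \<Sum>i<m x. f i x)"
proof -
  have *: "(\<Sum>i<n. g i) = rec_nat 0 (\<lambda>i y. y + g i) n" for n and g :: "nat \<Rightarrow> nat"
    by (induction n) auto
  show ?thesis
    unfolding *
    by (intro effective_intros effective_compose[OF assms(1), of "\<lambda>e. (fst e, snd (snd e))", simplified] assms)
qed

lemma length_le_encode: "length xs \<le> encode xs"
proof (induction xs)
  case (Cons x xs)
  then show ?case
    using le_prod_encode_2[of "encode xs" "encode x"] by (simp add: encode_list_def)
qed (simp add: encode_list_def)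

text \<open>Only recursion on numbers is at hand, so the nonempty suffixes are counted up to the
  bound \<open>encode xs\<close>, which is read off the code itself.\<close>

lemma effective_length [effective_intros]:
  assumes "effective f"
  shows "effective (\<lambda>x. length (f x))"
proof -
  have "length xs = (\<Sum>i<encode xs. if drop i xs = [] then 0 else 1)" for xs :: "'b list"
  proof -
    have "(\<Sum>i<encode xs. if drop i xs = [] then 0 else 1) = card ({..<encode xs} \<inter> {i. i < length xs})"
      by (simp add: sum.If_cases not_le flip: not_less) (simp add: Collect_neg_eq[symmetric] not_le)
    also have "{..<encode xs} \<inter> {i. i < length xs} = {..<length xs}"
      using length_le_encode[of xs] by auto
    finally show ?thesis by (simp only: card_lessThan)
  qed
  then show ?thesis
    by (simp only:) (intro effective_intros effective_sum effective_encode
        effective_compose[OF assms, of snd] assms)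
qed

text \<open>Lists grow at the front, so the recursion fills in the entries from the last to the
  first: stage \<open>i\<close> adds the one at \<open>m x - Suc i\<close>.\<close>

lemma effective_map_upt:
  assumes f: "effective (\<lambda>e. f (fst e) (snd e))" and m: "effective m"
  shows "effective (\<lambda>x. map (\<lambda>i. f i x) [0..<m x])"
proof -
  have *: "rec_nat [] (\<lambda>i y. g (n - Suc i) # y) k = map g [n - k..<n]" if "k \<le> n"
    for n k and g :: "nat \<Rightarrow> 'b"
    using that
  proof (induction k)
    case (Suc k)
    then have "[n - Suc k..<n] = (n - Suc k) # [n - k..<n]"
      by (simp add: upt_rec[of "n - Suc k"] Suc_diff_Suc)
    with Suc show ?case by simp
  qed simp
  have **: "map (\<lambda>i. f i x) [0..<m x] = rec_nat [] (\<lambda>i y. f (m x - Suc i) x # y) (m x)" for x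
    using *[of "m x" "m x" "\<lambda>i. f i x"] by simp
  show ?thesis
    unfolding **
    by (intro effective_intros m effective_compose[OF m]
        effective_compose[OF f, of "\<lambda>e. (m (snd (snd e)) - Suc (fst e), snd (snd e))", simplified])
qed

section \<open>Effective rational-valued functions\<close>

definition effective_rat :: "('a::coded \<Rightarrow> real) \<Rightarrow> bool" where
  "effective_rat f \<longleftrightarrow> (\<exists>c. effective c \<and> (\<forall>x. f x = rat_of_code (c x)))"

lemma effective_rat_compose: "effective_rat f \<Longrightarrow> effective g \<Longrightarrow> effective_rat (\<lambda>x. f (g x))"
  unfolding effective_rat_def using effective_compose by blast

lemma effective_rat_of_code [effective_intros]: "effective c \<Longrightarrow> effective_rat (\<lambda>x. rat_of_code (c x))"
  unfolding effective_rat_def by blast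

text \<open>Differences of natural numbers over a positive denominator avoid arithmetic on coded
  integers. The case distinction in \<open>d\<close> follows \<open>int_decode\<close>, which reads
  \<open>2 * m\<close> as \<open>m\<close> and \<open>Suc (2 * m)\<close> as
  \<open>- m - 1\<close>.\<close>

lemma effective_ratI:
  assumes "effective a" "effective b" "effective c"
    and f: "\<And>x. f x = (real (a x) - real (b x)) / real (Suc (c x))"
  shows "effective_rat f"
proof -
  define d where "d x = prod_encode
    (if a x < b x then Suc (2 * (b x - Suc (a x))) else 2 * (a x - b x), c x)" for x
  have "effective d"
    unfolding d_def using assms(1-3)
    by (intro effective_intros)
  moreover have "f x = rat_of_code (d x)" for x
    by (auto simp: f d_def rat_of_code_def int_decode_def sum_decode_def of_nat_diff not_less)
  ultimately show ?thesis
    unfolding effective_rat_def by blast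
qed

lemma effective_ratE:
  assumes "effective_rat f"
  shows "\<exists>a b c. effective a \<and> effective b \<and> effective c \<and>
    (\<forall>x. f x = (real (a x) - real (b x)) / real (Suc (c x)))"
proof -
  obtain d where d: "effective d" and f: "\<And>x. f x = rat_of_code (d x)"
    using assms unfolding effective_rat_def by blast
  define e where "e x = fst (prod_decode (d x))" for x
  have "effective e"
    unfolding e_def by (intro effective_intros d)
  then have "effective (\<lambda>x. if even (e x) then e x div 2 else 0)"
    "effective (\<lambda>x. if even (e x) then 0 else Suc (e x div 2))"
    "effective (\<lambda>x. snd (prod_decode (d x)))"
    by (intro effective_intros d; assumption)+
  moreover have "f x = (real (if even (e x) then e x div 2 else 0)
      - real (if even (e x) then 0 else Suc (e x div 2))) / real (Suc (snd (prod_decode (d x))))" for x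
    by (auto simp: f e_def rat_of_code_def int_decode_def sum_decode_def split: prod.split)
  ultimately show ?thesis by blast
qed

lemma effective_rat_of_nat [effective_intros]:
  assumes "effective f"
  shows "effective_rat (\<lambda>x. real (f x))"
  by (rule effective_ratI[OF assms effective_const[of 0] effective_const[of 0]]) simp

lemma effective_rat_zero [effective_intros]: "effective_rat (\<lambda>x. 0)"
  using effective_rat_of_nat[OF effective_const[of 0]] by simp

lemma effective_rat_one [effective_intros]: "effective_rat (\<lambda>x. 1)"
  using effective_rat_of_nat[OF effective_const[of 1]] by simp

lemma effective_rat_inverse_Suc [effective_intros]:
  assumes "effective f"
  shows "effective_rat (\<lambda>x. inverse (real (Suc (f x))))"
  by (rule effective_ratI[OF effective_const[of 1] effective_const[of 0] assms])
     (simp add: divide_simps)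

lemma effective_rat_diff [effective_intros]:
  assumes "effective_rat f" "effective_rat g"
  shows "effective_rat (\<lambda>x. f x - g x)"
proof -
  obtain a b c where 1: "effective a" "effective b" "effective c"
    and f: "\<And>x. f x = (real (a x) - real (b x)) / real (Suc (c x))"
    using effective_ratE[OF assms(1)] by blast
  obtain a' b' c' where 2: "effective a'" "effective b'" "effective c'"
    and g: "\<And>x. g x = (real (a' x) - real (b' x)) / real (Suc (c' x))"
    using effective_ratE[OF assms(2)] by blast
  show ?thesis
    by (rule effective_ratI[where
          a = "\<lambda>x. a x * Suc (c' x) + b' x * Suc (c x)" and
          b = "\<lambda>x. b x * Suc (c' x) + a' x * Suc (c x)" and
          c = "\<lambda>x. Suc (c x) * Suc (c' x) - 1"], (intro effective_intros 1 2)+)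
       (simp add: f g field_simps)
qed

lemma effective_rat_add [effective_intros]:
  "effective_rat f \<Longrightarrow> effective_rat g \<Longrightarrow> effective_rat (\<lambda>x. f x + g x)"
  using effective_rat_diff[OF _ effective_rat_diff[OF effective_rat_zero], of f g] by simp

lemma effective_rat_mult [effective_intros]:
  assumes "effective_rat f" "effective_rat g"
  shows "effective_rat (\<lambda>x. f x * g x)"
proof -
  obtain a b c where 1: "effective a" "effective b" "effective c"
    and f: "\<And>x. f x = (real (a x) - real (b x)) / real (Suc (c x))"
    using effective_ratE[OF assms(1)] by blast
  obtain a' b' c' where 2: "effective a'" "effective b'" "effective c'"
    and g: "\<And>x. g x = (real (a' x) - real (b' x)) / real (Suc (c' x))"
    using effective_ratE[OF assms(2)] by blast
  show ?thesis
    by (rule effective_ratI[where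
          a = "\<lambda>x. a x * a' x + b x * b' x" and
          b = "\<lambda>x. a x * b' x + b x * a' x" and
          c = "\<lambda>x. Suc (c x) * Suc (c' x) - 1"], (intro effective_intros 1 2)+)
       (simp add: f g field_simps)
qed

lemma effective_rat_less [effective_intros]:
  assumes "effective_rat f" "effective_rat g"
  shows "effective (\<lambda>x. f x < g x)"
proof -
  obtain a b c where 1: "effective a" "effective b" "effective c"
    and f: "\<And>x. f x = (real (a x) - real (b x)) / real (Suc (c x))"
    using effective_ratE[OF assms(1)] by blast
  obtain a' b' c' where 2: "effective a'" "effective b'" "effective c'"
    and g: "\<And>x. g x = (real (a' x) - real (b' x)) / real (Suc (c' x))"
    using effective_ratE[OF assms(2)] by blast
  have "f x < g x \<longleftrightarrow> real (a x * Suc (c' x) + b' x * Suc (c x)) < real (b x * Suc (c' x) + a' x * Suc (c x))" for x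
    unfolding f g by (simp add: field_simps del: of_nat_Suc) (simp add: field_simps)
  then have "f x < g x \<longleftrightarrow> a x * Suc (c' x) + b' x * Suc (c x) < b x * Suc (c' x) + a' x * Suc (c x)" for x
    by (simp only: of_nat_less_iff)
  then show ?thesis
    by (simp only:) (intro effective_intros 1 2)
qed

lemma effective_rat_if [effective_intros]:
  assumes "effective c" "effective_rat f" "effective_rat g"
  shows "effective_rat (\<lambda>x. if c x then f x else g x)"
proof -
  obtain cf cg where "effective cf" "effective cg"
    and "\<And>x. f x = rat_of_code (cf x)" "\<And>x. g x = rat_of_code (cg x)"
    using assms(2,3) unfolding effective_rat_def by blast
  with assms(1) show ?thesis
    unfolding effective_rat_def
    by (intro exI[of _ "\<lambda>x. if c x then cf x else cg x"]) (auto intro: effective_if)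
qed

text \<open>Real numbers carry no codes here, so the product is accumulated on codes of rationals,
  through an effective multiplication \<open>mul\<close>.\<close>

lemma effective_rat_prod:
  fixes f :: "nat \<Rightarrow> 'a::coded \<Rightarrow> real"
  assumes f: "effective_rat (\<lambda>e. f (fst e) (snd e))" and m: "effective m"
  shows "effective_rat (\<lambda>x. \<Prod>i<m x. f i x)"
proof -
  obtain cf where cf: "effective cf" and f_eq: "\<And>e. f (fst e) (snd e) = rat_of_code (cf e)"
    using f unfolding effective_rat_def by blast
  have "effective_rat (\<lambda>e :: nat \<times> nat. rat_of_code (fst e) * rat_of_code (snd e))"
    by (intro effective_intros)
  then obtain mul where mul: "effective mul"
    and mul_eq: "\<And>e. rat_of_code (fst e) * rat_of_code (snd e) = rat_of_code (mul e)"
    unfolding effective_rat_def by blast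
  obtain one where one: "1 = rat_of_code one"
    using effective_rat_one[where 'a = nat] unfolding effective_rat_def by blast
  define r where "r x = rec_nat one (\<lambda>i y. mul (y, cf (i, x))) (m x)" for x
  have "effective r"
    unfolding r_def
    by (intro effective_intros effective_compose[OF mul] effective_compose[OF cf] m)
  moreover have "(\<Prod>i<n. f i x) = rat_of_code (rec_nat one (\<lambda>i y. mul (y, cf (i, x))) n)" for n x
    by (induction n) (simp_all add: one mul_eq[of "(_, _)", simplified, symmetric] f_eq[of "(_, _)", simplified])
  ultimately show ?thesis
    unfolding effective_rat_def r_def by blast
qed

lemma effective_rat_power [effective_intros]:
  assumes "effective_rat f" "effective n"
  shows "effective_rat (\<lambda>x. f x ^ n x)"
  using effective_rat_prod[of "\<lambda>_. f" n,
      OF effective_rat_compose[OF assms(1) effective_snd[OF effective_id]] assms(2)]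
  by simp

section \<open>Infima of effective families\<close>

lemma effective_eval_of_code_less:
  assumes "effective f" "effective g"
  shows "effective (\<lambda>x. eval_of_code (f x) < eval_of_code (g x))"
proof -
  have "eval_of_code m < eval_of_code n \<longleftrightarrow>
      (if 0 < m then if 0 < n then rat_of_code (m - 1) < rat_of_code (n - 1) else True else False)" for m n
    by (cases m; cases n) (auto simp: eval_of_code_def)
  then show ?thesis
    by (simp only:) (intro effective_intros assms)
qed

text \<open>Semicomputability asks for a decreasing approximation, whereas \<open>A \<sigma>\<close>
  may list upper bounds in any order. The running minimum \<open>B\<close> repairs this; it is
  effective because coded values can be compared, and it starts with 0, the code of
  \<infinity>.\<close>

lemma upper_semicomputable_INF_nat:
  assumes A: "effective (\<lambda>e. A (fst e) (snd e))"
    and L: "\<And>\<sigma>. \<sigma> \<in> Zstar X \<Longrightarrow> L \<sigma> = (INF n :: nat. eval_of_code (A \<sigma> n))"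
  shows "upper_semicomputable X L"
proof -
  define B where "B \<sigma> = rec_nat 0
    (\<lambda>i y. if eval_of_code (A \<sigma> i) < eval_of_code y then A \<sigma> i else y)" for \<sigma>
  have "effective (\<lambda>e. B (fst e) (snd e))"
    unfolding B_def
    by (intro effective_intros effective_eval_of_code_less
        effective_compose[OF A, where g = "\<lambda>e. (fst (snd (snd e)), fst e)", simplified])
  then obtain h where h: "computable_nat h" and
    "\<And>e :: example list \<times> nat. h (encode e) = B (fst e) (snd e)"
    unfolding effective_def encode_nat_def by blast
  then have h_eq: "h (prod_encode (code_seq \<sigma>, n)) = B \<sigma> n" for \<sigma> n
    by (metis code_seq_eq_encode encode_nat_def encode_prod_def fst_conv snd_conv)
  have B_Suc: "eval_of_code (B \<sigma> (Suc n)) = min (eval_of_code (A \<sigma> n)) (eval_of_code (B \<sigma> n))" for \<sigma> n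
    by (auto simp: B_def min_def)
  have "antimono (\<lambda>n. eval_of_code (B \<sigma> n))" for \<sigma>
    by (rule decseq_SucI) (simp add: B_Suc)
  moreover have "(INF n. eval_of_code (B \<sigma> n)) = (INF n. eval_of_code (A \<sigma> n))" for \<sigma>
  proof (rule antisym)
    show "(INF n. eval_of_code (B \<sigma> n)) \<le> (INF n. eval_of_code (A \<sigma> n))"
    proof (rule INF_greatest)
      fix n
      show "(INF n. eval_of_code (B \<sigma> n)) \<le> eval_of_code (A \<sigma> n)"
        by (rule INF_lower2[of "Suc n"]) (simp_all add: B_Suc)
    qed
    have "(INF n. eval_of_code (A \<sigma> n)) \<le> eval_of_code (B \<sigma> n)" for n
    proof (induction n)
      case 0
      show ?case by (simp add: B_def eval_of_code_def)
    next
      case (Suc n)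
      then show ?case
        using INF_lower[of n UNIV "\<lambda>n. eval_of_code (A \<sigma> n)"] by (simp add: B_Suc)
    qed
    then show "(INF n. eval_of_code (A \<sigma> n)) \<le> (INF n. eval_of_code (B \<sigma> n))"
      by (rule INF_greatest)
  qed
  ultimately show ?thesis
    unfolding upper_semicomputable_def using h h_eq L by auto
qed

lemma upper_semicomputable_INF:
  fixes A :: "example list \<Rightarrow> 'w::coded \<Rightarrow> nat"
  assumes bij: "bij (encode :: 'w \<Rightarrow> nat)"
    and A: "effective (\<lambda>e. A (fst e) (snd e))"
    and L: "\<And>\<sigma>. \<sigma> \<in> Zstar X \<Longrightarrow> L \<sigma> = (INF w. eval_of_code (A \<sigma> w))"
  shows "upper_semicomputable X L"
proof (rule upper_semicomputable_INF_nat)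
  show "effective (\<lambda>e. A (fst e) (inv encode (snd e)))"
    by (rule effective_compose[OF A, of "\<lambda>e. (fst e, inv encode (snd e))", simplified])
       (intro effective_intros effective_compose[OF effective_inv_encode[OF bij]])
  have "range (inv (encode :: 'w \<Rightarrow> nat)) = UNIV"
    using bij by (simp add: bij_is_inj inj_imp_surj_inv)
  then show "L \<sigma> = (INF n. eval_of_code (A \<sigma> (inv encode n)))" if "\<sigma> \<in> Zstar X" for \<sigma>
    using L[OF that] image_image[of "\<lambda>w. eval_of_code (A \<sigma> w)" "inv encode" "UNIV :: nat set"]
    by simp
qed

section \<open>Proper mixable loss functions\<close>

definition outcome_prob :: "bool \<Rightarrow> real \<Rightarrow> real" where
  "outcome_prob y p = (if y then p else 1 - p)"

lemma outcome_prob_nonneg: "p \<in> {0..1} \<Longrightarrow> 0 \<le> outcome_prob y p"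
  by (auto simp: outcome_prob_def)

lemma loss_nonneg:
  assumes "loss_function lam" "p \<in> {0..1}"
  shows "0 \<le> lam y p"
proof (cases y)
  case True
  have "antimono_on {0..1} (lam True)" "lam True 1 = 0"
    using assms(1) by (auto simp: loss_function_def)
  with assms(2) True show ?thesis
    using monotone_onD[of "{0..1}" "(\<le>)" "(\<ge>)" "lam True" p 1] by auto
next
  case False
  have "mono_on {0..1} (lam False)" "lam False 0 = 0"
    using assms(1) by (auto simp: loss_function_def)
  with assms(2) False show ?thesis
    using mono_onD[of "{0..1}" "lam False" 0 p] by auto
qed

lemma loss_finite:
  assumes "loss_function lam" "p \<in> {0..1}" "outcome_prob y p \<noteq> 0"
  shows "\<bar>lam y p\<bar> \<noteq> \<infinity>"
proof -
  have "lam y p \<noteq> \<infinity>"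
  proof (cases "p \<in> {0<..<1}")
    case True
    then show ?thesis
      using assms(1) by (auto simp: loss_function_def)
  next
    case False
    with assms(2,3) have "p = (if y then 1 else 0)"
      by (auto simp: outcome_prob_def split: if_splits)
    then show ?thesis
      using assms(1) by (auto simp: loss_function_def)
  qed
  then show ?thesis
    using loss_nonneg[OF assms(1,2), of y] by auto
qed

lemma eexp_neg_nonneg: "0 \<le> eexp_neg \<eta> v"
  by (simp add: eexp_neg_def)

lemma eexp_neg_pos: "\<bar>v\<bar> \<noteq> \<infinity> \<Longrightarrow> 0 < eexp_neg \<eta> v"
  by (auto simp: eexp_neg_def)

lemma eexp_neg_le_1: "0 \<le> \<eta> \<Longrightarrow> 0 \<le> v \<Longrightarrow> eexp_neg \<eta> v \<le> 1"
  by (cases v) (auto simp: eexp_neg_def)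

text \<open>By properness, \<open>p\<close> minimises the expected loss over the superprediction set; first order
  optimality along the segment from the prediction \<open>p\<close> to the prediction \<open>q\<close>, which stays in the
  set by mixability, is the claim.\<close>

lemma proper_mixable_ineq:
  assumes lam: "loss_function lam" "proper lam" and \<eta>: "0 < \<eta>" and mix: "mixable_with \<eta> lam"
    and p: "p \<in> {0<..<1}" and q: "q \<in> {0..1}"
  shows "(\<Sum>y\<in>UNIV. outcome_prob y p * (eexp_neg \<eta> (lam y q) / eexp_neg \<eta> (lam y p))) \<le> 1"
proof -
  define U V d where "U y = eexp_neg \<eta> (lam y q)" and "V y = eexp_neg \<eta> (lam y p)"
    and "d y = U y / V y - 1" for y
  have fin: "\<bar>lam y p\<bar> \<noteq> \<infinity>" for y
    using p by (intro loss_finite[OF lam(1)]) (auto simp: outcome_prob_def)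
  have V: "0 < V y" for y
    unfolding V_def using fin by (rule eexp_neg_pos)
  have V1: "V y \<le> 1" and U1: "U y \<le> 1" and U0: "0 \<le> U y" for y
    unfolding V_def U_def using p q \<eta>
    by (auto intro!: eexp_neg_le_1 eexp_neg_nonneg loss_nonneg[OF lam(1)])
  have Vln: "ln (V y) = - \<eta> * real_of_ereal (lam y p)" for y
    unfolding V_def eexp_neg_def using fin[of y] by auto
  define S where "S = {(u::real, v::real). u \<in> {0..1} \<and> v \<in> {0..1} \<and>
      (\<exists>p\<in>{0..1}. u \<le> eexp_neg \<eta> (lam False p) \<and> v \<le> eexp_neg \<eta> (lam True p))}"
  have S: "convex S" using mix by (simp add: S_def mixable_with_def)
  have VS: "(V False, V True) \<in> S"
    using p V1 V by (auto simp: S_def V_def less_imp_le)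
  have US: "(U False, U True) \<in> S"
    using q U1 U0 by (auto simp: S_def U_def)
  have key: "p * ln (1 + \<epsilon> * d True) + (1 - p) * ln (1 + \<epsilon> * d False) \<le> 0"
    if \<epsilon>: "0 < \<epsilon>" "\<epsilon> < 1" for \<epsilon>
  proof -
    have dV: "V y * (1 + \<epsilon> * d y) = (1 - \<epsilon>) * V y + \<epsilon> * U y" for y
      using V[of y] by (simp add: d_def field_simps)
    \<comment> \<open>\<open>\<epsilon> < 1\<close> keeps the mixture positive even where
      \<open>q\<close> suffers infinite loss and \<open>U y = 0\<close>; hence the losses of
      \<open>r\<close> below are finite.\<close>
    have pos: "0 < V y * (1 + \<epsilon> * d y)" for y
      unfolding dV using V[of y] U0[of y] \<epsilon> by (simp add: add_pos_nonneg)
    have "(1 - \<epsilon>) *\<^sub>R (V False, V True) + \<epsilon> *\<^sub>R (U False, U True) \<in> S"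
      using \<epsilon> by (intro convexD[OF S VS US]) auto
    then have "(V False * (1 + \<epsilon> * d False), V True * (1 + \<epsilon> * d True)) \<in> S"
      unfolding dV by simp
    then obtain r where r: "r \<in> {0..1}"
      and "V False * (1 + \<epsilon> * d False) \<le> eexp_neg \<eta> (lam False r)"
        "V True * (1 + \<epsilon> * d True) \<le> eexp_neg \<eta> (lam True r)"
      unfolding S_def by auto
    then have le: "V y * (1 + \<epsilon> * d y) \<le> eexp_neg \<eta> (lam y r)" for y
      by (cases y) auto
    have finr: "\<bar>lam y r\<bar> \<noteq> \<infinity>" for y
      using le[of y] pos[of y] loss_nonneg[OF lam(1) r, of y] by (auto simp: eexp_neg_def)
    have lnle: "ln (V y) + ln (1 + \<epsilon> * d y) \<le> - \<eta> * real_of_ereal (lam y r)" for y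
    proof -
      have "0 < 1 + \<epsilon> * d y"
        using pos[of y] V[of y] by (simp add: zero_less_mult_iff)
      then have "ln (V y) + ln (1 + \<epsilon> * d y) = ln (V y * (1 + \<epsilon> * d y))"
        using V[of y] by (simp add: ln_mult)
      also have "\<dots> \<le> ln (eexp_neg \<eta> (lam y r))"
        using le[of y] pos[of y] by (intro ln_mono)
      also have "\<dots> = - \<eta> * real_of_ereal (lam y r)"
        using finr[of y] by (auto simp: eexp_neg_def)
      finally show ?thesis .
    qed
    have "ereal p * lam True p + ereal (1 - p) * lam False p
        \<le> ereal p * lam True r + ereal (1 - p) * lam False r"
      using lam(2) p r by (auto simp: proper_def)
    then have "p * real_of_ereal (lam True p) + (1 - p) * real_of_ereal (lam False p)
        \<le> p * real_of_ereal (lam True r) + (1 - p) * real_of_ereal (lam False r)"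
      using fin[of True] fin[of False] finr[of True] finr[of False] by auto
    then have "\<eta> * (p * real_of_ereal (lam True p) + (1 - p) * real_of_ereal (lam False p))
        \<le> \<eta> * (p * real_of_ereal (lam True r) + (1 - p) * real_of_ereal (lam False r))"
      using \<eta> by simp
    moreover have "p * (ln (V True) + ln (1 + \<epsilon> * d True)) \<le> p * (- \<eta> * real_of_ereal (lam True r))"
      "(1 - p) * (ln (V False) + ln (1 + \<epsilon> * d False)) \<le> (1 - p) * (- \<eta> * real_of_ereal (lam False r))"
      using p by (intro mult_left_mono lnle; simp)+
    ultimately show ?thesis
      unfolding Vln by (simp add: algebra_simps)
  qed
  \<comment> \<open>\<open>\<epsilon> * D\<close> is the first order part of \<open>key\<close>, and
    \<open>C\<close> controls the remainder through
    \<open>ln (1 + x) \<ge> x - 2 * x\<^sup>2\<close> for \<open>\<bar>x\<bar> \<le> 1/2\<close>.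
    Dividing by \<open>\<epsilon>\<close> and letting it tend to 0 leaves \<open>D \<le> 0\<close>,
    which is the claim because the probabilities sum to 1.\<close>
  define D C where "D = p * d True + (1 - p) * d False"
    and "C = p * (d True)\<^sup>2 + (1 - p) * (d False)\<^sup>2"
  have "D \<le> 2 * \<epsilon> * C"
    if \<epsilon>: "0 < \<epsilon>" "\<epsilon> < 1" "\<epsilon> * \<bar>d True\<bar> \<le> 1/2" "\<epsilon> * \<bar>d False\<bar> \<le> 1/2" for \<epsilon>
  proof -
    have "\<epsilon> * d y - 2 * (\<epsilon> * d y)\<^sup>2 \<le> ln (1 + \<epsilon> * d y)" for y
      using abs_ln_one_plus_x_minus_x_bound[of "\<epsilon> * d y"] \<epsilon> by (cases y) (auto simp: abs_mult)
    then have "p * (\<epsilon> * d True - 2 * (\<epsilon> * d True)\<^sup>2) \<le> p * ln (1 + \<epsilon> * d True)"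
      "(1 - p) * (\<epsilon> * d False - 2 * (\<epsilon> * d False)\<^sup>2) \<le> (1 - p) * ln (1 + \<epsilon> * d False)"
      using p by (auto intro!: mult_left_mono)
    with key[OF \<epsilon>(1,2)] have "\<epsilon> * D \<le> \<epsilon> * (2 * \<epsilon> * C)"
      by (simp add: D_def C_def algebra_simps power2_eq_square)
    then show ?thesis using \<epsilon>(1) by simp
  qed
  \<comment> \<open>The conjunct \<open>\<epsilon> * 1 \<le> 1/2\<close> yields
    \<open>\<epsilon> < 1\<close> in the shape of the other two, so one limit argument serves all
    three.\<close>
  moreover have "eventually (\<lambda>\<epsilon>. 0 < \<epsilon> \<and> \<epsilon> * 1 \<le> 1/2 \<and> \<epsilon> * \<bar>d True\<bar> \<le> 1/2 \<and> \<epsilon> * \<bar>d False\<bar> \<le> 1/2)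
      (at_right (0::real))"
  proof -
    have "eventually (\<lambda>\<epsilon>. \<epsilon> * a \<le> 1/2) (at_right (0::real))" for a :: real
    proof -
      have "((\<lambda>\<epsilon>. \<epsilon> * a) \<longlongrightarrow> 0 * a) (at_right (0::real))"
        by (intro tendsto_intros)
      then have "eventually (\<lambda>\<epsilon>. \<epsilon> * a < 1/2) (at_right (0::real))"
        by (rule order_tendstoD) simp
      then show ?thesis by (rule eventually_mono) simp
    qed
    then show ?thesis
      by (intro eventually_conj eventually_at_right_less)
  qed
  ultimately have "eventually (\<lambda>\<epsilon>. D \<le> 2 * \<epsilon> * C) (at_right 0)"
    by (auto elim!: eventually_mono)
  moreover have "((\<lambda>\<epsilon>. 2 * \<epsilon> * C) \<longlongrightarrow> 2 * 0 * C) (at_right 0)"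
    by (intro tendsto_intros)
  ultimately have "D \<le> 0"
    using tendsto_lowerbound[of "\<lambda>\<epsilon>. 2 * \<epsilon> * C" 0 "at_right 0" D] by simp
  then show ?thesis
    by (simp add: UNIV_bool outcome_prob_def D_def d_def U_def V_def algebra_simps)
qed

section \<open>Lowering the mixability rate\<close>

lemma exp_mult_le_convex_combination:
  fixes s z :: real
  assumes "0 \<le> s" "s \<le> 1"
  shows "exp (s * z) \<le> 1 + s * (exp z - 1)"
  using convex_onD[OF exp_convex, of s 0 z] assms by (simp add: algebra_simps)

text \<open>For finite \<open>u\<close> the left ratio is the \<open>s\<close>-th power of the right
  one, and for \<open>s \<le> 1\<close> such a power lies below its tangent at 1. For
  \<open>u = \<infinity>\<close> the claim reads \<open>0 \<le> 1 - s\<close>.\<close>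

lemma eexp_neg_ratio_le:
  assumes "0 \<le> s" "s \<le> 1" "\<bar>v\<bar> \<noteq> \<infinity>" "u \<noteq> - \<infinity>"
  shows "eexp_neg (s * \<eta>) u / eexp_neg (s * \<eta>) v \<le> 1 + s * (eexp_neg \<eta> u / eexp_neg \<eta> v - 1)"
proof (cases u)
  case (real r)
  obtain t where t: "v = ereal t" using assms(3) by auto
  have "exp (- (x * r)) / exp (- (x * t)) = exp (x * (t - r))" for x :: real
    by (simp add: algebra_simps flip: exp_diff)
  from this[of "s * \<eta>"] this[of \<eta>] show ?thesis
    using exp_mult_le_convex_combination[OF assms(1,2), of "\<eta> * (t - r)"]
    by (simp add: real t eexp_neg_def mult.assoc)
qed (use assms in \<open>auto simp: eexp_neg_def\<close>)

text \<open>Averaging the tangent bound turns a sum \<open>S\<close> at rate \<open>\<eta>\<close>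
  into at most \<open>1 + s * (S - 1)\<close>, which is at most 1 as soon as \<open>S\<close>
  is.\<close>

lemma proper_mixable_ineq_rescaled:
  assumes lam: "loss_function lam" "proper lam" "mixable lam"
  obtains N :: nat where "0 < N"
    and "\<And>p q. p \<in> {0..1} \<Longrightarrow> q \<in> {0..1} \<Longrightarrow>
      (\<Sum>y\<in>UNIV. outcome_prob y p * (eexp_neg (1 / N) (lam y q) / eexp_neg (1 / N) (lam y p))) \<le> 1"
proof -
  obtain \<eta> where \<eta>: "0 < \<eta>" "mixable_with \<eta> lam"
    using lam(3) by (auto simp: mixable_def)
  obtain N :: nat where N: "1 / \<eta> < N"
    using reals_Archimedean2 by blast
  moreover have "0 < 1 / \<eta>" using \<eta> by simp
  ultimately have N0: "0 < real N" by linarith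
  define s where "s = 1 / (N * \<eta>)"
  have s: "0 \<le> s" "s \<le> 1" "s * \<eta> = 1 / N"
    using N N0 \<eta> by (auto simp: s_def field_simps)
  show ?thesis
  proof (rule that)
    show "0 < N" using N0 by simp
    fix p q :: real assume p: "p \<in> {0..1}" and q: "q \<in> {0..1}"
    show "(\<Sum>y\<in>UNIV. outcome_prob y p * (eexp_neg (1 / N) (lam y q) / eexp_neg (1 / N) (lam y p))) \<le> 1"
    proof (cases "p \<in> {0<..<1}")
      case True
      define R where "R y = eexp_neg \<eta> (lam y q) / eexp_neg \<eta> (lam y p)" for y
      have "outcome_prob y p * (eexp_neg (1 / N) (lam y q) / eexp_neg (1 / N) (lam y p))
          \<le> outcome_prob y p * (1 + s * (R y - 1))" for y
        unfolding R_def s(3)[symmetric] using True p loss_nonneg[OF lam(1) q, of y]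
        by (intro mult_left_mono eexp_neg_ratio_le s loss_finite[OF lam(1)] outcome_prob_nonneg)
           (auto simp: outcome_prob_def)
      then have "(\<Sum>y\<in>UNIV. outcome_prob y p * (eexp_neg (1 / N) (lam y q) / eexp_neg (1 / N) (lam y p)))
          \<le> (\<Sum>y\<in>UNIV. outcome_prob y p * (1 + s * (R y - 1)))"
        by (rule sum_mono)
      also have "\<dots> = 1 + s * ((\<Sum>y\<in>UNIV. outcome_prob y p * R y) - 1)"
        by (simp add: UNIV_bool outcome_prob_def algebra_simps)
      also have "\<dots> \<le> 1"
        using proper_mixable_ineq[OF lam(1,2) \<eta> True q] s(1)
        by (simp add: R_def mult_nonneg_nonpos)
      finally show ?thesis .
    next
      \<comment> \<open>At an end point the impossible label has weight 0 and the certain one has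
        honest loss 0, so only \<open>eexp_neg\<close> of a nonnegative loss remains.\<close>
      case False
      then have "p = 0 \<or> p = 1" using p by auto
      moreover have "lam False 0 = 0" "lam True 1 = 0"
        using lam(1) by (auto simp: loss_function_def)
      ultimately show ?thesis
        using eexp_neg_le_1[OF _ loss_nonneg[OF lam(1) q], of "1 / N"]
        by (auto simp: UNIV_bool outcome_prob_def eexp_neg_def[of _ 0])
    qed
  qed
qed

section \<open>The induced superloss process under the log loss\<close>

text \<open>With \<open>outcome_prob\<close> this is the probability that \<open>F\<close> gives to
  the labels, with \<open>eexp_neg 1 (lam y p)\<close> it is exp(-Loss). In product form an infinite
  loss is an ordinary factor 0, and rational approximations can be multiplied.\<close>

definition path_prod ::
    "(bool \<Rightarrow> real \<Rightarrow> real) \<Rightarrow> (example list \<Rightarrow> nat \<Rightarrow> real) \<Rightarrow> example list \<Rightarrow> real" where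
  "path_prod w F \<sigma> = (\<Prod>t<length \<sigma>. w (snd (\<sigma> ! t)) (F (take t \<sigma>) (fst (\<sigma> ! t))))"

lemma path_prod_Nil [simp]: "path_prod w F [] = 1"
  by (simp add: path_prod_def)

lemma path_prod_snoc [simp]: "path_prod w F (\<sigma> @ [(x, y)]) = path_prod w F \<sigma> * w y (F \<sigma> x)"
  by (simp add: path_prod_def nth_append)

lemma Loss_Nil [simp]: "Loss lam F [] = 0"
  by (simp add: Loss_def)

lemma Loss_snoc [simp]: "Loss lam F (\<sigma> @ [(x, y)]) = Loss lam F \<sigma> + lam y (F \<sigma> x)"
  by (simp add: Loss_def nth_append)

lemma Zstar_Nil [simp]: "[] \<in> Zstar X"
  and Zstar_snoc [simp]: "\<sigma> @ [(x, y)] \<in> Zstar X \<longleftrightarrow> \<sigma> \<in> Zstar X \<and> x \<in> X"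
  by (auto simp: Zstar_def)

lemma Zstar_induct [consumes 1, case_names Nil snoc]:
  assumes "\<sigma> \<in> Zstar X" "Q []"
    and "\<And>\<sigma> x y. \<sigma> \<in> Zstar X \<Longrightarrow> x \<in> X \<Longrightarrow> Q \<sigma> \<Longrightarrow> Q (\<sigma> @ [(x, y)])"
  shows "Q \<sigma>"
  using assms(1)
proof (induction \<sigma> rule: rev_induct)
  case (snoc z \<sigma>)
  then show ?case
    using assms(3) by (cases z) auto
qed (rule assms(2))

text \<open>Where the probability vanishes, the loss under \<open>lam\<close> may be infinite too
  and the difference of losses has no meaning. Elsewhere both products are positive and their
  logarithms are minus the cumulative losses.\<close>

definition mixed_process ::
    "(bool \<Rightarrow> real \<Rightarrow> ereal) \<Rightarrow> (example list \<Rightarrow> nat \<Rightarrow> real) \<Rightarrow> (example list \<Rightarrow> ereal) \<Rightarrow> nat \<Rightarrow> example list \<Rightarrow> ereal" where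
  "mixed_process lam F K N \<sigma> = (if path_prod outcome_prob F \<sigma> = 0 \<or> K \<sigma> = \<infinity> then \<infinity>
     else ereal ((ln (path_prod (\<lambda>y p. eexp_neg 1 (lam y p)) F \<sigma>) + real_of_ereal (K \<sigma>)) / N
            - ln (path_prod outcome_prob F \<sigma>)))"

context
  fixes X :: "nat set" and lam :: "bool \<Rightarrow> real \<Rightarrow> ereal" and F :: "example list \<Rightarrow> nat \<Rightarrow> real"
  assumes lam: "loss_function lam"
    and F: "\<And>\<sigma> x. \<sigma> \<in> Zstar X \<Longrightarrow> x \<in> X \<Longrightarrow> F \<sigma> x \<in> {0..1}"
begin

lemma path_prob_nonneg: "\<sigma> \<in> Zstar X \<Longrightarrow> 0 \<le> path_prod outcome_prob F \<sigma>"
  by (induction rule: Zstar_induct) (simp_all add: outcome_prob_nonneg[OF F])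

text \<open>A loss can be infinite only on a label that the prediction gives probability 0.\<close>

lemma path_loss_pos:
  "\<sigma> \<in> Zstar X \<Longrightarrow> path_prod outcome_prob F \<sigma> \<noteq> 0 \<Longrightarrow>
    0 < path_prod (\<lambda>y p. eexp_neg 1 (lam y p)) F \<sigma>"
proof (induction rule: Zstar_induct)
  case (snoc \<sigma> x y)
  then show ?case
    using eexp_neg_pos[OF loss_finite[OF lam F]] by simp
qed simp

lemma Loss_eq_path_prod:
  "\<sigma> \<in> Zstar X \<Longrightarrow> path_prod outcome_prob F \<sigma> \<noteq> 0 \<Longrightarrow>
    Loss lam F \<sigma> = ereal (- ln (path_prod (\<lambda>y p. eexp_neg 1 (lam y p)) F \<sigma>))"
proof (induction rule: Zstar_induct)
  case (snoc \<sigma> x y)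
  then have pos: "0 < path_prod (\<lambda>y p. eexp_neg 1 (lam y p)) F \<sigma>"
    and fin: "\<bar>lam y (F \<sigma> x)\<bar> \<noteq> \<infinity>"
    using path_loss_pos loss_finite[OF lam F, of \<sigma> x y] by auto
  then have "ln (eexp_neg 1 (lam y (F \<sigma> x))) = - real_of_ereal (lam y (F \<sigma> x))"
    by (auto simp: eexp_neg_def)
  with snoc pos fin eexp_neg_pos[OF fin, of 1] show ?case
    by (auto simp: ln_mult)
qed simp

lemma Loss_log_loss:
  "\<sigma> \<in> Zstar X \<Longrightarrow> Loss log_loss F \<sigma> =
    (if path_prod outcome_prob F \<sigma> = 0 then \<infinity> else ereal (- ln (path_prod outcome_prob F \<sigma>)))"
proof (induction rule: Zstar_induct)
  case (snoc \<sigma> x y)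
  have "log_loss y p = (if outcome_prob y p = 0 then \<infinity> else ereal (- ln (outcome_prob y p)))" for p
    by (auto simp: log_loss_def outcome_prob_def)
  moreover have "0 \<le> path_prod outcome_prob F \<sigma>" "0 \<le> outcome_prob y (F \<sigma> x)"
    using snoc by (auto intro: path_prob_nonneg outcome_prob_nonneg F)
  ultimately show ?case
    using snoc by (auto simp: ln_mult)
qed simp

text \<open>With \<open>p\<close> the prediction of \<open>F\<close> and \<open>q\<close> the prediction witnessing the superloss property
  of \<open>K\<close>, the process grows by at least \<open>- ln (a y)\<close>, and the inequality for \<open>N\<close> says
  that \<open>a\<close> is a subprobability distribution.\<close>

lemma superloss_mixed_process:
  assumes K: "superloss_process X lam K" and N: "0 < N"
    and ineq: "\<And>p q. p \<in> {0..1} \<Longrightarrow> q \<in> {0..1} \<Longrightarrow>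
      (\<Sum>y\<in>UNIV. outcome_prob y p * (eexp_neg (1 / N) (lam y q) / eexp_neg (1 / N) (lam y p))) \<le> 1"
  shows "superloss_process X log_loss (mixed_process lam F K N)"
  unfolding superloss_process_def
proof (intro conjI ballI)
  fix \<sigma> x assume \<sigma>: "\<sigma> \<in> Zstar X" and x: "x \<in> X"
  define p where "p = F \<sigma> x"
  have p: "p \<in> {0..1}" using F \<sigma> x p_def by blast
  obtain q where q: "q \<in> {0..1}" and Kq: "\<And>y. K \<sigma> + lam y q \<le> K (\<sigma> @ [(x, y)])"
    using K \<sigma> x unfolding superloss_process_def by blast
  have K\<sigma>: "K \<sigma> \<noteq> -\<infinity>"
    using K \<sigma> by (auto simp: superloss_process_def)
  define a where "a y = outcome_prob y p * (eexp_neg (1 / N) (lam y q) / eexp_neg (1 / N) (lam y p))" for y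
  have a0: "0 \<le> a y" for y
    unfolding a_def by (intro mult_nonneg_nonneg divide_nonneg_nonneg eexp_neg_nonneg outcome_prob_nonneg p)
  have a1: "a True + a False \<le> 1"
    using ineq[OF p q] by (simp add: a_def UNIV_bool)
  \<comment> \<open>The log loss of predicting \<open>a True\<close> is at most
    \<open>- ln (a y)\<close> whenever \<open>a y\<close> is positive: on label 0 this uses
    \<open>a False \<le> 1 - a True\<close>.\<close>
  have "mixed_process lam F K N \<sigma> + log_loss y (a True) \<le> mixed_process lam F K N (\<sigma> @ [(x, y)])" for y
  proof (cases "mixed_process lam F K N (\<sigma> @ [(x, y)]) = \<infinity>")
    case False
    let ?P = "path_prod outcome_prob F" and ?G = "path_prod (\<lambda>y p. eexp_neg 1 (lam y p)) F"
    let ?K = "\<lambda>\<sigma>. real_of_ereal (K \<sigma>)"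
    from False have nz: "?P \<sigma> \<noteq> 0" "outcome_prob y p \<noteq> 0" and K': "K (\<sigma> @ [(x, y)]) \<noteq> \<infinity>"
      by (auto simp: mixed_process_def p_def split: if_splits)
    have pos: "0 < ?P \<sigma>" "0 < outcome_prob y p" "0 < ?G \<sigma>"
      using nz path_prob_nonneg[OF \<sigma>] outcome_prob_nonneg[OF p, of y] path_loss_pos[OF \<sigma>] by auto
    have finp: "\<bar>lam y p\<bar> \<noteq> \<infinity>"
      using loss_finite[OF lam p nz(2)] .
    \<comment> \<open>Neither \<open>K \<sigma>\<close> nor \<open>lam y q\<close> is
      \<open>-\<infinity>\<close>, so a value of \<open>K\<close> below \<infinity> on the extension
      makes all three finite.\<close>
    have finK: "\<bar>K \<sigma>\<bar> \<noteq> \<infinity>" and finq: "\<bar>lam y q\<bar> \<noteq> \<infinity>" and finK': "\<bar>K (\<sigma> @ [(x, y)])\<bar> \<noteq> \<infinity>"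
      using Kq[of y] K' K\<sigma> loss_nonneg[OF lam q, of y]
      by (cases "K \<sigma>"; cases "lam y q"; cases "K (\<sigma> @ [(x, y)])"; simp)+
    have apos: "0 < a y"
      unfolding a_def using pos(2) eexp_neg_pos[OF finp] eexp_neg_pos[OF finq] by simp
    have "log_loss y (a True) \<le> ereal (- ln (a y))"
    proof (cases y)
      case True
      then show ?thesis using apos by (simp add: log_loss_def)
    next
      case False
      then have "a True \<noteq> 1" "ln (a False) \<le> ln (1 - a True)"
        using apos a1 by (auto intro!: ln_mono)
      with False show ?thesis by (simp add: log_loss_def)
    qed
    moreover have "ln (a y) = ln (outcome_prob y p) + (real_of_ereal (lam y p) - real_of_ereal (lam y q)) / N"
      using finp finq pos(2) by (auto simp: a_def eexp_neg_def ln_mult ln_div diff_divide_distrib)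
    moreover have "ln (?G (\<sigma> @ [(x, y)])) = ln (?G \<sigma>) - real_of_ereal (lam y p)"
      using pos(3) finp eexp_neg_pos[OF finp, of 1]
      by (auto simp: ln_mult p_def[symmetric]) (auto simp: eexp_neg_def)
    moreover have "ln (?P (\<sigma> @ [(x, y)])) = ln (?P \<sigma>) + ln (outcome_prob y p)"
      using pos by (simp add: ln_mult p_def[symmetric])
    moreover have "?K \<sigma> / N + real_of_ereal (lam y q) / N \<le> ?K (\<sigma> @ [(x, y)]) / N"
    proof -
      have "?K \<sigma> + real_of_ereal (lam y q) \<le> ?K (\<sigma> @ [(x, y)])"
        using Kq[of y] finK finq finK' by auto
      then show ?thesis
        unfolding add_divide_distrib[symmetric] by (rule divide_right_mono) simp
    qed
    moreover have "mixed_process lam F K N \<sigma> = ereal ((ln (?G \<sigma>) + ?K \<sigma>) / N - ln (?P \<sigma>))"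
      using nz finK by (auto simp: mixed_process_def)
    moreover have "mixed_process lam F K N (\<sigma> @ [(x, y)])
        = ereal ((ln (?G (\<sigma> @ [(x, y)])) + ?K (\<sigma> @ [(x, y)])) / N - ln (?P (\<sigma> @ [(x, y)])))"
      using False unfolding mixed_process_def by presburger
    ultimately have "mixed_process lam F K N \<sigma> + ereal (- ln (a y)) \<le> mixed_process lam F K N (\<sigma> @ [(x, y)])"
      and "log_loss y (a True) \<le> ereal (- ln (a y))"
      by (simp_all only: plus_ereal.simps ereal_less_eq add_divide_distrib diff_divide_distrib)
    then show ?thesis
      using add_left_mono order_trans by blast
  qed simp
  moreover have "a True \<in> {0..1}"
    using a0[of True] a0[of False] a1 by auto
  ultimately show "\<exists>p\<in>{0..1}. \<forall>y. mixed_process lam F K N (\<sigma> @ [(x, y)]) \<ge> mixed_process lam F K N \<sigma> + log_loss y p"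
    by blast
qed (simp add: mixed_process_def)

lemma deficiency_le:
  assumes \<sigma>: "\<sigma> \<in> Zstar X" and N: "0 < N"
    and K: "superloss_process X lam K" and Klog: "superloss_process X log_loss Klog"
    and le: "Klog \<sigma> \<le> mixed_process lam F K N \<sigma> + ereal c"
    and b: "deficiency log_loss F Klog \<sigma> \<le> ereal b"
  shows "deficiency lam F K \<sigma> \<le> ereal (N * (b + c))"
proof -
  let ?P = "path_prod outcome_prob F \<sigma>" and ?G = "path_prod (\<lambda>y p. eexp_neg 1 (lam y p)) F \<sigma>"
  \<comment> \<open>In \<open>ereal\<close>, \<open>\<infinity> - v\<close> is \<infinity> for every
    \<open>v\<close>, so a finite bound on the deficiency under the log loss excludes probability
    0.\<close>
  have nz: "?P \<noteq> 0"
    using b by (auto simp: deficiency_def Loss_log_loss[OF \<sigma>])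
  have K\<sigma>: "K \<sigma> \<noteq> -\<infinity>" "Klog \<sigma> \<noteq> -\<infinity>"
    using K Klog \<sigma> by (auto simp: superloss_process_def)
  show ?thesis
  proof (cases "K \<sigma> = \<infinity>")
    case True
    then show ?thesis
      by (simp add: deficiency_def Loss_eq_path_prod[OF \<sigma> nz])
  next
    case False
    then obtain k where k: "K \<sigma> = ereal k" using K\<sigma> by (cases "K \<sigma>") auto
    then obtain l where l: "Klog \<sigma> = ereal l"
      using le K\<sigma> nz by (cases "Klog \<sigma>") (auto simp: mixed_process_def)
    have "l \<le> (ln ?G + k) / N - ln ?P + c"
      using le nz by (simp add: k l mixed_process_def)
    moreover have "- ln ?P - l \<le> b"
      using b nz by (simp add: deficiency_def Loss_log_loss[OF \<sigma>] l)
    ultimately have "- ((ln ?G + k) / N) \<le> b + c" by linarith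
    then have "- ln ?G - k \<le> N * (b + c)"
      using N by (simp add: field_simps)
    then show ?thesis
      by (simp add: deficiency_def Loss_eq_path_prod[OF \<sigma> nz] k)
  qed
qed

end

section \<open>Upper semicomputability of the induced process\<close>

lemma effective_curried2:
  assumes "effective (\<lambda>e. f (fst e) (snd e))" "effective a" "effective b"
  shows "effective (\<lambda>x. f (a x) (b x))"
  using effective_compose[OF assms(1) effective_Pair[OF assms(2,3)]] by simp

lemma effective_curried3:
  assumes "effective (\<lambda>e. f (fst e) (fst (snd e)) (snd (snd e)))" "effective a" "effective b" "effective c"
  shows "effective (\<lambda>x. f (a x) (b x) (c x))"
  using effective_compose[OF assms(1) effective_Pair[OF assms(2) effective_Pair[OF assms(3,4)]]] by simp

lemma effective_curried4:
  assumes "effective (\<lambda>e. f (fst e) (fst (snd e)) (fst (snd (snd e))) (snd (snd (snd e))))"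
    and "effective a" "effective b" "effective c" "effective d"
  shows "effective (\<lambda>x. f (a x) (b x) (c x) (d x))"
  using effective_compose[OF assms(1)
      effective_Pair[OF assms(2) effective_Pair[OF assms(3) effective_Pair[OF assms(4,5)]]]] by simp

lemma effective_rat_curried2:
  assumes "effective_rat (\<lambda>e. f (fst e) (snd e))" "effective a" "effective b"
  shows "effective_rat (\<lambda>x. f (a x) (b x))"
  using effective_rat_compose[OF assms(1) effective_Pair[OF assms(2,3)]] by simp

lemma effective_rat_curried3:
  assumes "effective_rat (\<lambda>e. f (fst e) (fst (snd e)) (snd (snd e)))" "effective a" "effective b" "effective c"
  shows "effective_rat (\<lambda>x. f (a x) (b x) (c x))"
  using effective_rat_compose[OF assms(1) effective_Pair[OF assms(2) effective_Pair[OF assms(3,4)]]] by simp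

lemma effective_rat_curried4:
  assumes "effective_rat (\<lambda>e. f (fst e) (fst (snd e)) (fst (snd (snd e))) (snd (snd (snd e))))"
    and "effective a" "effective b" "effective c" "effective d"
  shows "effective_rat (\<lambda>x. f (a x) (b x) (c x) (d x))"
  using effective_rat_compose[OF assms(1)
      effective_Pair[OF assms(2) effective_Pair[OF assms(3) effective_Pair[OF assms(4,5)]]]] by simp

lemma effective_rat_positive_part:
  assumes "effective_rat f"
  shows "effective_rat (\<lambda>x. max 0 (f x))"
proof -
  have "max 0 r = (if 0 < r then r else 0)" for r :: real by auto
  moreover have "effective_rat (\<lambda>x. if 0 < f x then f x else 0)"
    by (intro effective_intros assms)
  ultimately show ?thesis by simp
qed

lemma effective_list_encode [effective_intros]:
  "effective f \<Longrightarrow> effective (\<lambda>x. list_encode (f x))"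
proof -
  have "encode xs = list_encode xs" for xs :: "nat list"
    unfolding encode_list_def encode_nat_def by simp
  then show "effective f \<Longrightarrow> ?thesis"
    using effective_encode[of f] by simp
qed

lemma effective_code_seq [effective_intros]: "effective f \<Longrightarrow> effective (\<lambda>x. code_seq (f x))"
  unfolding code_seq_eq_encode by (rule effective_encode)

lemma effective_rat_inverse_power2 [effective_intros]:
  assumes "effective f"
  shows "effective_rat (\<lambda>x. inverse (2 ^ f x))"
proof -
  have "effective_rat (\<lambda>x. inverse (real (Suc 1)) ^ f x)"
    by (intro effective_intros assms)
  moreover have "inverse (real (Suc 1)) ^ n = inverse (2 ^ n)" for n
    by (simp add: power_inverse[symmetric])
  ultimately show ?thesis by simp
qed

lemma inverse_power2_tendsto: "(\<lambda>k. inverse (2 ^ k) :: real) \<longlonglongrightarrow> 0"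
  using LIMSEQ_inverse_realpow_zero[of 2] by simp

section \<open>Rational approximations along a data sequence\<close>

context
  fixes X :: "nat set" and lam :: "bool \<Rightarrow> real \<Rightarrow> ereal" and F :: "example list \<Rightarrow> nat \<Rightarrow> real"
    and hF :: "nat \<Rightarrow> nat" and hL :: "bool \<Rightarrow> nat \<Rightarrow> nat"
  assumes lam: "loss_function lam"
    and F: "\<And>\<sigma> x. \<sigma> \<in> Zstar X \<Longrightarrow> x \<in> X \<Longrightarrow> F \<sigma> x \<in> {0..1}"
    and hF_comp: "computable_nat hF"
    and hF: "\<And>\<sigma> x k. \<sigma> \<in> Zstar X \<Longrightarrow> x \<in> X \<Longrightarrow>
      \<bar>rat_of_code (hF (prod_encode (code_seq \<sigma>, prod_encode (x, k)))) - F \<sigma> x\<bar> \<le> inverse (2 ^ k)"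
    and hL_comp: "\<And>y. computable_nat (hL y)"
    and hL_halts: "\<And>y p r n. p \<in> {0..1} \<Longrightarrow> real_name r p \<Longrightarrow>
      \<exists>k. hL y (prod_encode (list_encode (map r [0..<k]), n)) \<noteq> 0"
    and hL_approx: "\<And>y p r n k c. p \<in> {0..1} \<Longrightarrow> real_name r p \<Longrightarrow>
      hL y (prod_encode (list_encode (map r [0..<k]), n)) = Suc c \<Longrightarrow>
      \<bar>rat_of_code c - eexp_neg 1 (lam y p)\<bar> \<le> inverse (2 ^ n)"
begin

text \<open>For \<open>t < length \<sigma>\<close> this is a name of the prediction made after \<open>take t \<sigma>\<close>; the
  prefix and the next example are written with \<open>hd\<close> and \<open>drop\<close>, which are effective
  without a bound on \<open>t\<close>.\<close>

definition pred_name :: "example list \<Rightarrow> nat \<Rightarrow> nat \<Rightarrow> nat" where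
  "pred_name \<sigma> t k = hF (prod_encode (code_seq (map (\<lambda>i. hd (drop i \<sigma>)) [0..<t]),
     prod_encode (fst (hd (drop t \<sigma>)), k)))"

text \<open>Subtracting the error gives a lower bound; clipping at 0 keeps the factors nonnegative,
  so that their product is a lower bound as well.\<close>

definition prob_below :: "example list \<Rightarrow> nat \<Rightarrow> nat \<Rightarrow> real" where
  "prob_below \<sigma> t k = max 0
     (outcome_prob (snd (hd (drop t \<sigma>))) (rat_of_code (pred_name \<sigma> t k)) - inverse (2 ^ k))"

text \<open>The first nonzero answer among the first \<open>m\<close> queries of the loss machine, or \<open>0\<close>.\<close>

definition loss_answer :: "example list \<Rightarrow> nat \<Rightarrow> nat \<Rightarrow> nat \<Rightarrow> nat" where
  "loss_answer \<sigma> t k m = rec_nat 0 (\<lambda>j y. if 0 < y then y else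
     hL (snd (hd (drop t \<sigma>))) (prod_encode (list_encode (map (\<lambda>i. pred_name \<sigma> t i) [0..<j]), k))) m"

text \<open>While the machine is silent the value 1 is used, which bounds exp(-loss) because losses
  are nonnegative.\<close>

definition exp_loss_above :: "example list \<Rightarrow> nat \<Rightarrow> nat \<Rightarrow> nat \<Rightarrow> real" where
  "exp_loss_above \<sigma> t k m = (if 0 < loss_answer \<sigma> t k m
     then rat_of_code (loss_answer \<sigma> t k m - 1) + inverse (2 ^ k) else 1)"

text \<open>The process increases with exp(-Loss) and decreases with the probability of the labels,
  so bounding it from above needs the latter from below and the former from above.\<close>

definition path_prob_below :: "example list \<Rightarrow> nat \<Rightarrow> real" where
  "path_prob_below \<sigma> k = (\<Prod>t<length \<sigma>. prob_below \<sigma> t k)"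

definition path_exp_loss_above :: "example list \<Rightarrow> nat \<Rightarrow> nat \<Rightarrow> real" where
  "path_exp_loss_above \<sigma> k m = (\<Prod>t<length \<sigma>. exp_loss_above \<sigma> t k m)"

lemma effective_pred_name: "effective (\<lambda>e. pred_name (fst e) (fst (snd e)) (snd (snd e)))"
  unfolding pred_name_def
  by (intro effective_nat[OF hF_comp] effective_map_upt effective_intros)

lemma effective_prob_below: "effective_rat (\<lambda>e. prob_below (fst e) (fst (snd e)) (snd (snd e)))"
  unfolding prob_below_def outcome_prob_def
  by (intro effective_rat_positive_part effective_intros effective_curried3[OF effective_pred_name])

lemma effective_hL:
  assumes "effective b" "effective f"
  shows "effective (\<lambda>x. hL (b x) (f x))"
proof -
  have *: "hL (b x) (f x) = (if b x then hL True (f x) else hL False (f x))" for x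
    by (cases "b x") auto
  show ?thesis
    unfolding * by (intro effective_intros effective_nat[OF hL_comp] assms)
qed

lemma effective_loss_answer:
  "effective (\<lambda>e. loss_answer (fst e) (fst (snd e)) (fst (snd (snd e))) (snd (snd (snd e))))"
  unfolding loss_answer_def
  by (intro effective_intros effective_hL effective_map_upt effective_curried3[OF effective_pred_name])

lemma effective_exp_loss_above:
  "effective_rat (\<lambda>e. exp_loss_above (fst e) (fst (snd e)) (fst (snd (snd e))) (snd (snd (snd e))))"
  unfolding exp_loss_above_def
  by (intro effective_intros effective_curried4[OF effective_loss_answer])

lemma effective_path_prob_below: "effective_rat (\<lambda>e. path_prob_below (fst e) (snd e))"
  unfolding path_prob_below_def
  by (intro effective_rat_prod effective_intros effective_rat_curried3[OF effective_prob_below])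

lemma effective_path_exp_loss_above:
  "effective_rat (\<lambda>e. path_exp_loss_above (fst e) (fst (snd e)) (snd (snd e)))"
  unfolding path_exp_loss_above_def
  by (intro effective_rat_prod effective_intros effective_rat_curried4[OF effective_exp_loss_above])

context
  fixes \<sigma> :: "example list"
  assumes \<sigma>: "\<sigma> \<in> Zstar X"
begin

lemma pred_name_eq:
  "t < length \<sigma> \<Longrightarrow> pred_name \<sigma> t k =
    hF (prod_encode (code_seq (take t \<sigma>), prod_encode (fst (\<sigma> ! t), k)))"
proof -
  assume t: "t < length \<sigma>"
  then have "map (\<lambda>i. hd (drop i \<sigma>)) [0..<t] = take t \<sigma>"
    by (intro nth_equalityI) (auto simp: hd_drop_conv_nth)
  with t show ?thesis
    by (simp add: pred_name_def hd_drop_conv_nth)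
qed

lemma take_Zstar: "take t \<sigma> \<in> Zstar X"
  using \<sigma> set_take_subset[of t \<sigma>] by (auto simp: Zstar_def lists_eq_set)

lemma object_mem: "t < length \<sigma> \<Longrightarrow> fst (\<sigma> ! t) \<in> X"
  using \<sigma> nth_mem[of t \<sigma>]
  by (metis Zstar_def in_listsD mem_Times_iff)

abbreviation prediction :: "nat \<Rightarrow> real" where
  "prediction t \<equiv> F (take t \<sigma>) (fst (\<sigma> ! t))"

abbreviation label :: "nat \<Rightarrow> bool" where
  "label t \<equiv> snd (\<sigma> ! t)"

lemma prediction_mem: "t < length \<sigma> \<Longrightarrow> prediction t \<in> {0..1}"
  by (intro F take_Zstar object_mem)

lemma real_name_pred_name: "t < length \<sigma> \<Longrightarrow> real_name (pred_name \<sigma> t) (prediction t)"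
  unfolding real_name_def using hF[OF take_Zstar object_mem] by (simp add: pred_name_eq)

lemma prob_below_bounds:
  assumes t: "t < length \<sigma>"
  shows "0 \<le> prob_below \<sigma> t k"
    and "prob_below \<sigma> t k \<le> outcome_prob (label t) (prediction t)"
    and "outcome_prob (label t) (prediction t) - 2 * inverse (2 ^ k) \<le> prob_below \<sigma> t k"
proof -
  have "\<bar>rat_of_code (pred_name \<sigma> t k) - prediction t\<bar> \<le> inverse (2 ^ k)"
    using real_name_pred_name[OF t] by (simp add: real_name_def)
  moreover have "0 \<le> outcome_prob (label t) (prediction t)"
    by (rule outcome_prob_nonneg[OF prediction_mem[OF t]])
  ultimately show "0 \<le> prob_below \<sigma> t k"
    "prob_below \<sigma> t k \<le> outcome_prob (label t) (prediction t)"
    "outcome_prob (label t) (prediction t) - 2 * inverse (2 ^ k) \<le> prob_below \<sigma> t k"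
    using t by (auto simp: prob_below_def hd_drop_conv_nth outcome_prob_def split: if_splits)
qed

lemma prob_below_tendsto:
  assumes t: "t < length \<sigma>"
  shows "(\<lambda>k. prob_below \<sigma> t k) \<longlonglongrightarrow> outcome_prob (label t) (prediction t)"
proof (rule real_tendsto_sandwich)
  have "(\<lambda>k. outcome_prob (label t) (prediction t) - 2 * inverse (2 ^ k))
      \<longlonglongrightarrow> outcome_prob (label t) (prediction t) - 2 * 0"
    by (intro tendsto_intros inverse_power2_tendsto)
  then show "(\<lambda>k. outcome_prob (label t) (prediction t) - 2 * inverse (2 ^ k))
      \<longlonglongrightarrow> outcome_prob (label t) (prediction t)"
    by simp
qed (use prob_below_bounds[OF t] in auto)

lemma loss_answer_Suc:
  "t < length \<sigma> \<Longrightarrow> loss_answer \<sigma> t k (Suc m) =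
    (if 0 < loss_answer \<sigma> t k m then loss_answer \<sigma> t k m
     else hL (label t) (prod_encode (list_encode (map (pred_name \<sigma> t) [0..<m]), k)))"
  by (auto simp: loss_answer_def hd_drop_conv_nth)

lemma loss_answer_correct:
  assumes t: "t < length \<sigma>" and pos: "0 < loss_answer \<sigma> t k m"
  shows "\<bar>rat_of_code (loss_answer \<sigma> t k m - 1) - eexp_neg 1 (lam (label t) (prediction t))\<bar>
    \<le> inverse (2 ^ k)"
  using pos
proof (induction m)
  case 0
  then show ?case by (simp add: loss_answer_def)
next
  case (Suc m)
  show ?case
  proof (cases "0 < loss_answer \<sigma> t k m")
    case False
    with Suc.prems obtain c where
      "hL (label t) (prod_encode (list_encode (map (pred_name \<sigma> t) [0..<m]), k)) = Suc c"
      unfolding loss_answer_Suc[OF t] using gr0_implies_Suc by auto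
    moreover from this have "loss_answer \<sigma> t k (Suc m) = Suc c"
      using False by (simp add: loss_answer_Suc[OF t])
    ultimately show ?thesis
      using hL_approx[OF prediction_mem[OF t] real_name_pred_name[OF t]] by simp
  qed (use Suc loss_answer_Suc[OF t] in simp)
qed

lemma loss_answer_eventually:
  assumes t: "t < length \<sigma>"
  shows "eventually (\<lambda>m. 0 < loss_answer \<sigma> t k m) sequentially"
proof -
  obtain m where m: "hL (label t) (prod_encode (list_encode (map (pred_name \<sigma> t) [0..<m]), k)) \<noteq> 0"
    using hL_halts[OF prediction_mem[OF t] real_name_pred_name[OF t]] by blast
  have "0 < loss_answer \<sigma> t k n" if "Suc m \<le> n" for n
    using that
  proof (induction n rule: dec_induct)
    case base
    then show ?case using m by (simp add: loss_answer_Suc[OF t])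
  qed (simp add: loss_answer_Suc[OF t])
  then show ?thesis
    unfolding eventually_sequentially by blast
qed

lemma exp_loss_above_ge:
  assumes t: "t < length \<sigma>"
  shows "eexp_neg 1 (lam (label t) (prediction t)) \<le> exp_loss_above \<sigma> t k m"
  using loss_answer_correct[OF t, of k m] eexp_neg_le_1[OF _ loss_nonneg[OF lam prediction_mem[OF t]], of 1]
  by (auto simp: exp_loss_above_def)

lemma exp_loss_above_le:
  assumes t: "t < length \<sigma>" and "0 < loss_answer \<sigma> t k m"
  shows "exp_loss_above \<sigma> t k m \<le> eexp_neg 1 (lam (label t) (prediction t)) + 2 * inverse (2 ^ k)"
  using loss_answer_correct[OF assms] assms(2) by (auto simp: exp_loss_above_def)

lemma path_prod_outcome_prob_nonneg: "0 \<le> path_prod outcome_prob F \<sigma>"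
  by (rule path_prob_nonneg[OF lam _ \<sigma>]) (rule F)

lemma path_prod_exp_loss_pos:
  "path_prod outcome_prob F \<sigma> \<noteq> 0 \<Longrightarrow> 0 < path_prod (\<lambda>y p. eexp_neg 1 (lam y p)) F \<sigma>"
  by (rule path_loss_pos[OF lam _ \<sigma>]) (rule F)

lemma path_prob_below_nonneg: "0 \<le> path_prob_below \<sigma> k"
  unfolding path_prob_below_def using prob_below_bounds by (auto intro: prod_nonneg)

lemma path_prob_below_le: "path_prob_below \<sigma> k \<le> path_prod outcome_prob F \<sigma>"
  unfolding path_prob_below_def path_prod_def using prob_below_bounds by (auto intro!: prod_mono)

lemma path_prob_below_tendsto: "(\<lambda>k. path_prob_below \<sigma> k) \<longlonglongrightarrow> path_prod outcome_prob F \<sigma>"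
  unfolding path_prob_below_def path_prod_def using prob_below_tendsto by (auto intro!: tendsto_prod)

lemma path_exp_loss_above_ge:
  "path_prod (\<lambda>y p. eexp_neg 1 (lam y p)) F \<sigma> \<le> path_exp_loss_above \<sigma> k m"
  unfolding path_exp_loss_above_def path_prod_def
  using exp_loss_above_ge eexp_neg_nonneg by (auto intro!: prod_mono)

text \<open>Higher precision may take more queries, so their number depends on \<open>k\<close>. One
  number serves all \<open>t\<close> because the sequence is finite and an answer, once given, is
  kept.\<close>

lemma path_exp_loss_above_tendsto:
  obtains m where "(\<lambda>k. path_exp_loss_above \<sigma> k (m k)) \<longlonglongrightarrow> path_prod (\<lambda>y p. eexp_neg 1 (lam y p)) F \<sigma>"
proof -
  have "eventually (\<lambda>m. \<forall>t\<in>{..<length \<sigma>}. 0 < loss_answer \<sigma> t k m) sequentially" for k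
    using loss_answer_eventually by (intro eventually_ball_finite) auto
  then have "\<exists>m. \<forall>t<length \<sigma>. 0 < loss_answer \<sigma> t k m" for k
    using eventually_happens'[OF sequentially_bot] by fastforce
  then obtain m where m: "\<And>k t. t < length \<sigma> \<Longrightarrow> 0 < loss_answer \<sigma> t k (m k)"
    by metis
  have "(\<lambda>k. exp_loss_above \<sigma> t k (m k)) \<longlonglongrightarrow> eexp_neg 1 (lam (label t) (prediction t))"
    if t: "t < length \<sigma>" for t
  proof (rule real_tendsto_sandwich[where f = "\<lambda>_. eexp_neg 1 (lam (label t) (prediction t))"])
    have "(\<lambda>k. eexp_neg 1 (lam (label t) (prediction t)) + 2 * inverse (2 ^ k))
        \<longlonglongrightarrow> eexp_neg 1 (lam (label t) (prediction t)) + 2 * 0"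
      by (intro tendsto_intros inverse_power2_tendsto)
    then show "(\<lambda>k. eexp_neg 1 (lam (label t) (prediction t)) + 2 * inverse (2 ^ k))
        \<longlonglongrightarrow> eexp_neg 1 (lam (label t) (prediction t))"
      by simp
  qed (use exp_loss_above_ge[OF t] exp_loss_above_le[OF t m[OF t]] in auto)
  then show ?thesis
    by (intro that[of m]) (auto simp: path_exp_loss_above_def path_prod_def intro!: tendsto_prod)
qed

end

section \<open>Certificates for upper bounds\<close>

context
  fixes K :: "example list \<Rightarrow> ereal" and hK :: "nat \<Rightarrow> nat" and N :: nat
  assumes hK_comp: "computable_nat hK"
    and hK: "\<And>\<sigma>. \<sigma> \<in> Zstar X \<Longrightarrow>
      (INF n. eval_of_code (hK (prod_encode (code_seq \<sigma>, n)))) = K \<sigma>"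
    and K: "\<And>\<sigma>. \<sigma> \<in> Zstar X \<Longrightarrow> K \<sigma> \<noteq> -\<infinity>"
    and N: "0 < N"
begin

text \<open>A witness \<open>(n, a, b, k, m, j)\<close> certifies an upper bound for the process: the rational
  \<open>x = a / (b + 1)\<close> stands for \<open>1 + u / n\<close>, so that \<open>x ^ n\<close> is a rational lower bound
  for \<open>exp u\<close>, which avoids computing logarithms.\<close>

definition certificate_holds :: "example list \<Rightarrow> nat \<times> nat \<times> nat \<times> nat \<times> nat \<times> nat \<Rightarrow> bool" where
  "certificate_holds \<sigma> w \<longleftrightarrow>
     path_exp_loss_above \<sigma> (fst (snd (snd (snd w)))) (fst (snd (snd (snd (snd w))))) <
     path_prob_below \<sigma> (fst (snd (snd (snd w)))) ^ N *
       (real (fst (snd w)) * inverse (real (Suc (fst (snd (snd w)))))) ^ fst w"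

text \<open>The logarithm of a certified inequality and \<open>ln x \<le> x - 1\<close> bound
  \<open>N\<close> times the process by \<open>n * (x - 1)\<close> plus an upper bound of
  \<open>K\<close>. The code is lowered by 1 to undo the successor in \<open>eval_of_code\<close>;
  \<open>Suc (N - 1)\<close> is \<open>N\<close> written as a denominator.\<close>

definition certificate_value :: "example list \<Rightarrow> nat \<times> nat \<times> nat \<times> nat \<times> nat \<times> nat \<Rightarrow> real" where
  "certificate_value \<sigma> w =
     (rat_of_code (hK (prod_encode (code_seq \<sigma>, snd (snd (snd (snd (snd w)))))) - 1) +
       real (fst w) * (real (fst (snd w)) * inverse (real (Suc (fst (snd (snd w))))) - 1))
     * inverse (real (Suc (N - 1)))"

lemma effective_certificate_holds: "effective (\<lambda>e. certificate_holds (fst e) (snd e))"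
  unfolding certificate_holds_def
  by (intro effective_rat_less effective_intros effective_rat_curried3[OF effective_path_exp_loss_above]
      effective_rat_curried2[OF effective_path_prob_below])

lemma effective_certificate_value: "effective_rat (\<lambda>e. certificate_value (fst e) (snd e))"
  unfolding certificate_value_def
  by (intro effective_intros effective_nat[OF hK_comp])

lemma certificate_sound:
  assumes \<sigma>: "\<sigma> \<in> Zstar X" and cert: "certificate_holds \<sigma> (n, a, b, k, m, j)"
    and pos: "0 < hK (prod_encode (code_seq \<sigma>, j))"
  shows "mixed_process lam F K N \<sigma> \<le> ereal (certificate_value \<sigma> (n, a, b, k, m, j))"
proof -
  let ?P = "path_prod outcome_prob F \<sigma>" and ?G = "path_prod (\<lambda>y p. eexp_neg 1 (lam y p)) F \<sigma>"
  define x where "x = real a * inverse (real (Suc b))"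
  define s where "s = rat_of_code (hK (prod_encode (code_seq \<sigma>, j)) - 1)"
  have x: "0 \<le> x" by (simp add: x_def)
  have G0: "0 \<le> ?G"
    unfolding path_prod_def by (intro prod_nonneg) (simp add: eexp_neg_nonneg)
  have P0: "0 \<le> ?P"
    using path_prod_outcome_prob_nonneg[OF \<sigma>] .
  have "?G \<le> path_exp_loss_above \<sigma> k m"
    by (rule path_exp_loss_above_ge[OF \<sigma>])
  also have "\<dots> < path_prob_below \<sigma> k ^ N * x ^ n"
    using cert by (simp add: certificate_holds_def x_def)
  also have "\<dots> \<le> ?P ^ N * exp (x - 1) ^ n"
    using path_prob_below_nonneg[OF \<sigma>] path_prob_below_le[OF \<sigma>] x exp_ge_add_one_self[of "x - 1"] P0
    by (intro mult_mono power_mono) auto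
  finally have less: "?G < ?P ^ N * exp (n * (x - 1))"
    by (simp add: exp_of_nat_mult)
  \<comment> \<open>With probability 0 the right side would be 0, as \<open>N\<close> is positive,
    but \<open>?G\<close> is nonnegative: such a sequence has no certificate.\<close>
  then have "?P \<noteq> 0"
    using G0 N by (auto simp: power_0_left)
  then have P: "0 < ?P" and G: "0 < ?G"
    using P0 path_prod_exp_loss_pos[OF \<sigma>] by auto
  have "ln ?G < ln (?P ^ N * exp (n * (x - 1)))"
    using less G by simp
  then have lnG: "ln ?G < N * ln ?P + n * (x - 1)"
    using P by (simp add: ln_mult ln_realpow)
  have "K \<sigma> \<le> eval_of_code (hK (prod_encode (code_seq \<sigma>, j)))"
    unfolding hK[OF \<sigma>, symmetric] by (rule INF_lower) simp
  also have "\<dots> = ereal s"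
    using pos by (auto simp: s_def eval_of_code_def split: nat.split)
  finally have "K \<sigma> \<le> ereal s" .
  then obtain \<kappa> where \<kappa>: "K \<sigma> = ereal \<kappa>" "\<kappa> \<le> s"
    using K[OF \<sigma>] by (cases "K \<sigma>") auto
  have "ln ?G + \<kappa> \<le> (s + n * (x - 1)) + ln ?P * N"
    using lnG \<kappa>(2) by (simp add: mult.commute)
  then have "(ln ?G + \<kappa>) / N - ln ?P \<le> (s + n * (x - 1)) / N"
    using divide_right_mono[of "ln ?G + \<kappa>" "(s + n * (x - 1)) + ln ?P * N" "real N"] N
    by (simp add: add_divide_distrib)
  moreover have "certificate_value \<sigma> (n, a, b, k, m, j) = (s + n * (x - 1)) / N"
    using N by (simp add: certificate_value_def s_def x_def divide_inverse del: of_nat_Suc)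
  ultimately show ?thesis
    using P by (simp add: mixed_process_def \<kappa>)
qed

text \<open>Since \<open>(1 + v / n) ^ n\<close> tends to \<open>exp v\<close>, a rational power
  beats \<open>exp u\<close> at arbitrarily small cost in the exponent; the resulting inequality is
  strict and survives good enough approximations of both products.\<close>

lemma certificate_complete:
  assumes \<sigma>: "\<sigma> \<in> Zstar X" and fin: "mixed_process lam F K N \<sigma> \<noteq> \<infinity>" and \<epsilon>: "0 < \<epsilon>"
  obtains n a b k m j where "certificate_holds \<sigma> (n, a, b, k, m, j)"
    and "0 < hK (prod_encode (code_seq \<sigma>, j))"
    and "ereal (certificate_value \<sigma> (n, a, b, k, m, j)) \<le> mixed_process lam F K N \<sigma> + ereal \<epsilon>"
proof -
  let ?P = "path_prod outcome_prob F \<sigma>" and ?G = "path_prod (\<lambda>y p. eexp_neg 1 (lam y p)) F \<sigma>"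
  have P: "0 < ?P" and G: "0 < ?G" and "K \<sigma> \<noteq> \<infinity>"
    using fin path_prod_outcome_prob_nonneg[OF \<sigma>] path_prod_exp_loss_pos[OF \<sigma>]
    by (auto simp: mixed_process_def less_le split: if_splits)
  then obtain \<kappa> where \<kappa>: "K \<sigma> = ereal \<kappa>"
    using K[OF \<sigma>] by (cases "K \<sigma>") auto
  \<comment> \<open>Chosen so that \<open>?G = ?P ^ N * exp u\<close>; the process then equals
    \<open>(u + \<kappa>) / N\<close>.\<close>
  define u where "u = ln ?G - N * ln ?P"
  \<comment> \<open>The total budget is \<open>N * \<epsilon>\<close>: one \<open>\<delta>\<close>
    for approximating \<open>K\<close>, two for the rational \<open>x\<close>, and the fourth is
    slack.\<close>
  define \<delta> where "\<delta> = N * \<epsilon> / 4"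
  have \<delta>: "0 < \<delta>" using N \<epsilon> by (simp add: \<delta>_def)
  have "(INF n. eval_of_code (hK (prod_encode (code_seq \<sigma>, n)))) < ereal (\<kappa> + \<delta>)"
    using \<delta> by (simp add: hK[OF \<sigma>] \<kappa>)
  then obtain j where j: "eval_of_code (hK (prod_encode (code_seq \<sigma>, j))) < ereal (\<kappa> + \<delta>)"
    unfolding INF_less_iff by blast
  define s where "s = rat_of_code (hK (prod_encode (code_seq \<sigma>, j)) - 1)"
  have pos: "0 < hK (prod_encode (code_seq \<sigma>, j))" and s: "s < \<kappa> + \<delta>"
    using j by (auto simp: s_def eval_of_code_def split: nat.splits)
  have "(\<lambda>n. (1 + (u + \<delta>) / real n) ^ n) \<longlonglongrightarrow> exp (u + \<delta>)"
    by (rule tendsto_exp_limit_sequentially)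
  then have "eventually (\<lambda>n. exp u < (1 + (u + \<delta>) / real n) ^ n) sequentially"
    using \<delta> by (intro order_tendstoD) auto
  \<comment> \<open>This makes the base \<open>1 + (u + \<delta>) / n\<close> positive, so that
    replacing it by a larger \<open>x\<close> increases the power.\<close>
  moreover have "eventually (\<lambda>n. \<bar>u + \<delta>\<bar> < real n) sequentially"
    using filterlim_at_top_dense filterlim_real_sequentially by blast
  ultimately obtain n where n: "exp u < (1 + (u + \<delta>) / real n) ^ n" "\<bar>u + \<delta>\<bar> < real n"
    using eventually_happens'[OF sequentially_bot eventually_conj] by blast
  then have n0: "0 < real n" by linarith
  have "1 + (u + \<delta>) / n < 1 + (u + 2 * \<delta>) / n"
    using \<delta> n0 by (simp add: field_simps)
  then obtain x where x: "x \<in> \<rat>" "1 + (u + \<delta>) / n < x" "x < 1 + (u + 2 * \<delta>) / n"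
    using Rats_dense_in_real by blast
  have base: "0 < 1 + (u + \<delta>) / n"
    using n n0 by (simp add: field_simps)
  with x have x0: "0 < x" by linarith
  obtain a b where ab: "x = real a * inverse (real (Suc b))"
  proof -
    obtain a c where "c \<noteq> 0" "\<bar>x\<bar> = real a / real c"
      using Rats_abs_nat_div_natE[OF x(1)] by metis
    then show ?thesis
      using x0 that[of a "c - 1"] by (simp add: divide_inverse)
  qed
  have "n * (x - 1) < u + 2 * \<delta>"
    using x(3) n0 by (simp add: field_simps)
  have "?G = ?P ^ N * exp u"
    using P G by (simp add: u_def exp_diff exp_of_nat_mult)
  also have "\<dots> < ?P ^ N * x ^ n"
  proof -
    have "exp u < (1 + (u + \<delta>) / n) ^ n" by (rule n)
    also have "\<dots> \<le> x ^ n"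
      using x base by (intro power_mono) auto
    finally show ?thesis using P by simp
  qed
  finally have less: "?G < ?P ^ N * x ^ n" .
  obtain m where m: "(\<lambda>k. path_exp_loss_above \<sigma> k (m k)) \<longlonglongrightarrow> ?G"
    by (rule path_exp_loss_above_tendsto[OF \<sigma>])
  have "(\<lambda>k. path_prob_below \<sigma> k ^ N * x ^ n - path_exp_loss_above \<sigma> k (m k))
      \<longlonglongrightarrow> ?P ^ N * x ^ n - ?G"
    by (intro tendsto_intros m path_prob_below_tendsto[OF \<sigma>])
  then have "eventually (\<lambda>k. 0 < path_prob_below \<sigma> k ^ N * x ^ n - path_exp_loss_above \<sigma> k (m k)) sequentially"
    using less by (intro order_tendstoD) auto
  then obtain k where k: "path_exp_loss_above \<sigma> k (m k) < path_prob_below \<sigma> k ^ N * x ^ n"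
    using eventually_happens'[OF sequentially_bot] by fastforce
  show ?thesis
  proof (rule that)
    show "certificate_holds \<sigma> (n, a, b, k, m k, j)"
      using k by (simp add: certificate_holds_def ab)
    show "0 < hK (prod_encode (code_seq \<sigma>, j))" by (rule pos)
    have "certificate_value \<sigma> (n, a, b, k, m k, j) = (s + n * (x - 1)) / N"
      using N by (simp add: certificate_value_def s_def ab divide_inverse del: of_nat_Suc)
    also have "\<dots> \<le> (\<kappa> + u + 4 * \<delta>) / N"
      using s \<open>n * (x - 1) < u + 2 * \<delta>\<close> \<delta> by (intro divide_right_mono) auto
    also have "\<dots> = (ln ?G + \<kappa>) / N - ln ?P + \<epsilon>"
      using N by (simp add: u_def \<delta>_def field_simps)
    finally show "ereal (certificate_value \<sigma> (n, a, b, k, m k, j)) \<le> mixed_process lam F K N \<sigma> + ereal \<epsilon>"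
      using P by (simp add: mixed_process_def \<kappa>)
  qed
qed

lemma upper_semicomputable_mixed_process_aux: "upper_semicomputable X (mixed_process lam F K N)"
proof -
  obtain c where c: "effective c" and
    value_eq: "\<And>e. certificate_value (fst e) (snd e) = rat_of_code (c e)"
    using effective_certificate_value unfolding effective_rat_def by blast
  \<comment> \<open>A tuple that certifies nothing gets the code 0, that is \<infinity>, and leaves
    the infimum unchanged.\<close>
  define A where "A \<sigma> w = (if 0 < hK (prod_encode (code_seq \<sigma>, snd (snd (snd (snd (snd w))))))
    then if certificate_holds \<sigma> w then Suc (c (\<sigma>, w)) else 0 else 0)" for \<sigma> w
  have "effective (\<lambda>e. A (fst e) (snd e))"
    unfolding A_def
    by (intro effective_intros effective_nat[OF hK_comp] effective_curried2[OF effective_certificate_holds]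
        effective_compose[OF c])
  moreover have "bij (encode :: nat \<times> nat \<times> nat \<times> nat \<times> nat \<times> nat \<Rightarrow> nat)"
    by (intro bij_encode_prod bij_encode_nat)
  moreover have "mixed_process lam F K N \<sigma> = (INF w. eval_of_code (A \<sigma> w))" if \<sigma>: "\<sigma> \<in> Zstar X" for \<sigma>
  proof (rule antisym)
    show "mixed_process lam F K N \<sigma> \<le> (INF w. eval_of_code (A \<sigma> w))"
    proof (rule INF_greatest)
      fix w
      show "mixed_process lam F K N \<sigma> \<le> eval_of_code (A \<sigma> w)"
        using certificate_sound[OF \<sigma>, of "fst w" "fst (snd w)" "fst (snd (snd w))"
            "fst (snd (snd (snd w)))" "fst (snd (snd (snd (snd w))))" "snd (snd (snd (snd (snd w))))"]
          value_eq[of "(\<sigma>, w)"]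
        by (simp add: A_def eval_of_code_def)
    qed
    show "(INF w. eval_of_code (A \<sigma> w)) \<le> mixed_process lam F K N \<sigma>"
    proof (rule ereal_le_epsilon2)
      fix \<epsilon> :: real assume \<epsilon>: "0 < \<epsilon>"
      show "(INF w. eval_of_code (A \<sigma> w)) \<le> mixed_process lam F K N \<sigma> + ereal \<epsilon>"
      proof (cases "mixed_process lam F K N \<sigma> = \<infinity>")
        case False
        obtain n a b k m j where cert: "certificate_holds \<sigma> (n, a, b, k, m, j)"
          "0 < hK (prod_encode (code_seq \<sigma>, j))"
          "ereal (certificate_value \<sigma> (n, a, b, k, m, j)) \<le> mixed_process lam F K N \<sigma> + ereal \<epsilon>"
          by (rule certificate_complete[OF \<sigma> False \<epsilon>])
        have "eval_of_code (A \<sigma> (n, a, b, k, m, j)) = ereal (certificate_value \<sigma> (n, a, b, k, m, j))"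
          using cert(1,2) value_eq[of "(\<sigma>, n, a, b, k, m, j)"] by (simp add: A_def eval_of_code_def)
        with cert(3) show ?thesis
          by (intro INF_lower2[of "(n, a, b, k, m, j)"]) auto
      qed simp
    qed
  qed
  ultimately show ?thesis
    using upper_semicomputable_INF by blast
qed

end

end

lemma upper_semicomputable_mixed_process:
  assumes lam: "loss_function lam" "computable_loss lam" and F: "prediction_algorithm X F"
    and K: "upper_semicomputable X K" "superloss_process X lam K" and N: "0 < N"
  shows "upper_semicomputable X (mixed_process lam F K N)"
proof -
  obtain hF where hF: "computable_nat hF" "\<And>\<sigma> x k. \<sigma> \<in> Zstar X \<Longrightarrow> x \<in> X \<Longrightarrow>
      \<bar>rat_of_code (hF (prod_encode (code_seq \<sigma>, prod_encode (x, k)))) - F \<sigma> x\<bar> \<le> inverse (2 ^ k)"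
    using F unfolding prediction_algorithm_def by blast
  have F01: "\<And>\<sigma> x. \<sigma> \<in> Zstar X \<Longrightarrow> x \<in> X \<Longrightarrow> F \<sigma> x \<in> {0..1}"
    using F unfolding prediction_algorithm_def by blast
  obtain hL where hL: "\<And>y. computable_nat (hL y)"
    and halts: "\<And>y p r n. p \<in> {0..1} \<Longrightarrow> real_name r p \<Longrightarrow>
      \<exists>k. hL y (prod_encode (list_encode (map r [0..<k]), n)) \<noteq> 0"
    and approx: "\<And>y p r n k c. p \<in> {0..1} \<Longrightarrow> real_name r p \<Longrightarrow>
      hL y (prod_encode (list_encode (map r [0..<k]), n)) = Suc c \<Longrightarrow>
      \<bar>rat_of_code c - eexp_neg 1 (lam y p)\<bar> \<le> inverse (2 ^ n)"
    using lam(2) unfolding computable_loss_def computable_on_unit_def by metis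
  obtain hK where hK: "computable_nat hK" "\<And>\<sigma>. \<sigma> \<in> Zstar X \<Longrightarrow>
      (INF n. eval_of_code (hK (prod_encode (code_seq \<sigma>, n)))) = K \<sigma>"
    using K(1) unfolding upper_semicomputable_def by blast
  have K0: "\<And>\<sigma>. \<sigma> \<in> Zstar X \<Longrightarrow> K \<sigma> \<noteq> -\<infinity>"
    using K(2) unfolding superloss_process_def by blast
  show ?thesis
    by (rule upper_semicomputable_mixed_process_aux[OF lam(1) F01 hF hL halts approx hK K0 N])
qed

section \<open>Comparison of the two deficiencies\<close>

theorem theorem1:
  fixes X :: "nat set"
    and lam :: "bool \<Rightarrow> real \<Rightarrow> ereal"
    and F :: "example list \<Rightarrow> nat \<Rightarrow> real"
    and \<zeta> :: "nat \<Rightarrow> example"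
    and Klog Klam :: "example list \<Rightarrow> ereal"
  assumes "finite X"
    and "CPM_loss lam"
    and "prediction_algorithm X F"
    and "\<forall>t. fst (\<zeta> t) \<in> X"
    and "predictive_complexity X log_loss Klog"
    and "predictive_complexity X lam Klam"
    and "random_wrt log_loss F Klog \<zeta>"
  shows "random_wrt lam F Klam \<zeta>"
proof -
  have lam: "loss_function lam" "computable_loss lam" "proper lam" "mixable lam"
    using assms(2) by (auto simp: CPM_loss_def)
  have F: "F \<sigma> x \<in> {0..1}" if "\<sigma> \<in> Zstar X" "x \<in> X" for \<sigma> x
    using assms(3) that by (auto simp: prediction_algorithm_def)
  have Klam: "upper_semicomputable X Klam" "superloss_process X lam Klam"
    using assms(6) by (auto simp: predictive_complexity_def)
  have Klog: "superloss_process X log_loss Klog"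
    using assms(5) by (auto simp: predictive_complexity_def)
  obtain N :: nat where N: "0 < N" and ineq: "\<And>p q. p \<in> {0..1} \<Longrightarrow> q \<in> {0..1} \<Longrightarrow>
      (\<Sum>y\<in>UNIV. outcome_prob y p * (eexp_neg (1 / N) (lam y q) / eexp_neg (1 / N) (lam y p))) \<le> 1"
    using proper_mixable_ineq_rescaled[OF lam(1,3,4)] by blast
  have "upper_semicomputable X (mixed_process lam F Klam N)"
    by (rule upper_semicomputable_mixed_process[OF lam(1,2) assms(3) Klam N])
  moreover have "superloss_process X log_loss (mixed_process lam F Klam N)"
    by (rule superloss_mixed_process[OF lam(1) F Klam(2) N ineq])
  ultimately obtain c where c: "\<And>\<sigma>. \<sigma> \<in> Zstar X \<Longrightarrow> Klog \<sigma> \<le> mixed_process lam F Klam N \<sigma> + ereal c"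
    using assms(5) unfolding predictive_complexity_def by blast
  obtain b where b: "(SUP T. deficiency log_loss F Klog (prefix_of \<zeta> T)) \<le> ereal b"
    using assms(7) unfolding random_wrt_def
    by (metis ereal_dense2 less_imp_le)
  \<comment> \<open>Here \<open>c\<close> comes from the minimality of \<open>Klog\<close>,
    \<open>b\<close> bounds the deficiency under the log loss, and the factor \<open>N\<close>
    undoes the rescaling; none of them depends on \<open>T\<close>.\<close>
  have "deficiency lam F Klam (prefix_of \<zeta> T) \<le> ereal (N * (b + c))" for T
  proof -
    have \<sigma>: "prefix_of \<zeta> T \<in> Zstar X"
      using assms(4) unfolding prefix_of_def Zstar_def lists_eq_set
      by (simp add: image_subset_iff mem_Times_iff)
    have b_T: "deficiency log_loss F Klog (prefix_of \<zeta> T) \<le> ereal b"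
      by (rule order_trans[OF SUP_upper b]) simp
    show ?thesis
      by (rule deficiency_le[OF lam(1) F \<sigma> N Klam(2) Klog c[OF \<sigma>] b_T])
  qed
  then have "(SUP T. deficiency lam F Klam (prefix_of \<zeta> T)) \<le> ereal (N * (b + c))"
    by (rule SUP_least)
  then show ?thesis
    unfolding random_wrt_def by (rule le_less_trans) simp
qed

end
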